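(* Let $X$ be a Riemann surface and let $\mathcal{V}$ be a projectively flat holomorphic vector bundle of rank $n$ over $X$. (1) Let $A$ and $B$ be meromorphic sections of $\mathcal{V}$ with $B$ generic. The Wronskian quotient $\frac{A}{B}$, given on each coordinate chart $U$ carrying a projectively flat trivialization of $\mathcal{V}$ by the matrix $W(B)^{-1}W(A)$, is independent of the choice of local chart (coordinate) and of projectively flat trivialization, and hence is a well-defined meromorphic section of $\mathrm{End}(\mathcal{V})$. (2) For any three generic meromorphic sections $A, B, C$ of $\mathcal{V}$, $$\frac{A}{B}\cdot\frac{C}{A}\cdot\frac{B}{C}=1,$$ where $1$ is the identity endomorphism of $\mathcal{V}$, and for any nonzero meromorphic function $f$ on $X$, $$\frac{fA}{fB}=\frac{A}{B}.$$
   Context: Riemann surfaces are connected. A holomorphic vector bundle $\mathcal{V}$ of rank $n$ over $X$ is projectively flat if there are an open cover $\{U_i\}$ of $X$ and holomorphic trivializations of $\mathcal{V}$ over the $U_i$ whose transition functions on $U_i\cap U_j$ have the form $\lambda_{ij}T_{ij}$, with $\lambda_{ij}:U_i\cap U_j\to\mathbb{C}^\times$ holomorphic and $T_{ij}\in GL_n(\mathbb{C})$ constant. Such a structure is regarded as fixed; a projectively flat trivialization means a local trivialization related to those of the structure by transition functions of this form (nowhere-zero holomorphic scalar times locally constant invertible matrix). Local sections are written as row vectors of component functions, so the components of a section $A$ in two trivializations are related by $A_i=\lambda_{ij}A_jT_{ij}$. For a (connected) coordinate chart $U$ with coordinate $z$ and a projectively flat trivialization over $U$, a meromorphic section $A$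 has components $(a_1,\dots,a_n)$; its Wronskian matrix $W(A)$ is the $n\times n$ matrix whose $i$-th row is $(a_1^{(i-1)},\dots,a_n^{(i-1)})$, $i=1,\dots,n$ (derivatives with respect to $z$), and $w(A)=\det W(A)$. The section $A$ is generic if $w(A)\not\equiv0$; this does not depend on the chart or projectively flat trivialization. A matrix $Q$ acts as an endomorphism on row vectors by $v\mapsto vQ$, so that under a change of trivialization with constant part $T$ an endomorphism transforms by $Q\mapsto T^{-1}QT$. In the product formulas the order is that of the corresponding matrices. *)

theory Defs
  imports "HOL-Complex_Analysis.Complex_Analysis"
begin

section \<open>Riemann surfaces\<close>

record 'a surface =
  surf_top :: "'a topology"
  surf_atlas :: "('a set \<times> ('a \<Rightarrow> complex)) set"

definition complex_chart :: "'a topology \<Rightarrow> 'a set \<Rightarrow> ('a \<Rightarrow> complex) \<Rightarrow> bool" where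
  "complex_chart T U z \<longleftrightarrow>
     openin T U \<and> open (z ` U) \<and>
     homeomorphic_map (subtopology T U) (top_of_set (z ` U)) z"

definition holo_change :: "'a set \<Rightarrow> ('a \<Rightarrow> complex) \<Rightarrow> 'a set \<Rightarrow> ('a \<Rightarrow> complex) \<Rightarrow> bool" where
  "holo_change U z U' z' \<longleftrightarrow> (z' \<circ> inv_into U z) holomorphic_on (z ` (U \<inter> U'))"

definition riemann_surface :: "'a surface \<Rightarrow> bool" where
  "riemann_surface X \<longleftrightarrow>
     topspace (surf_top X) \<noteq> {} \<and> connected_space (surf_top X) \<and> Hausdorff_space (surf_top X) \<and>
     (\<Union>(U, z)\<in>surf_atlas X. U) = topspace (surf_top X) \<and>
     (\<forall>(U, z)\<in>surf_atlas X. complex_chart (surf_top X) U z) \<and>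
     (\<forall>(U, z)\<in>surf_atlas X. \<forall>(U', z')\<in>surf_atlas X. holo_change U z U' z')"

definition coord_chart :: "'a surface \<Rightarrow> 'a set \<Rightarrow> ('a \<Rightarrow> complex) \<Rightarrow> bool" where
  "coord_chart X U z \<longleftrightarrow>
     connectedin (surf_top X) U \<and> complex_chart (surf_top X) U z \<and>
     (\<forall>(U', z')\<in>surf_atlas X. holo_change U z U' z' \<and> holo_change U' z' U z)"

definition holo_on :: "'a surface \<Rightarrow> 'a set \<Rightarrow> ('a \<Rightarrow> complex) \<Rightarrow> bool" where
  "holo_on X S f \<longleftrightarrow>
     (\<forall>(U, z)\<in>surf_atlas X. (f \<circ> inv_into U z) holomorphic_on (z ` (U \<inter> S)))"

text \<open>
  As with the library predicate \<^const>\<open>meromorphic_on\<close>, a meromorphic object is represented by a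
  total function whose values on a closed discrete set (in particular at the poles) are irrelevant.
  Equations between meromorphic objects on an open set \<open>S\<close> are accordingly read off such a set,
  which is what \<open>mero_ae\<close> expresses.
\<close>

definition mero_ae :: "'a surface \<Rightarrow> 'a set \<Rightarrow> ('a \<Rightarrow> bool) \<Rightarrow> bool" where
  "mero_ae X S R \<longleftrightarrow> (\<forall>x\<in>S. eventually R (atin (surf_top X) x))"

definition meromorphic_fun :: "'a surface \<Rightarrow> ('a \<Rightarrow> complex) \<Rightarrow> bool" where
  "meromorphic_fun X f \<longleftrightarrow>
     (\<forall>(U, z)\<in>surf_atlas X. (f \<circ> inv_into U z) meromorphic_on (z ` U))"

definition nonzero_fun :: "'a surface \<Rightarrow> ('a \<Rightarrow> complex) \<Rightarrow> bool" where
  "nonzero_fun X f \<longleftrightarrow> \<not> mero_ae X (topspace (surf_top X)) (\<lambda>x. f x = 0)"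


section \<open>Holomorphic vector bundles\<close>

text \<open>
  A bundle of rank \<open>CARD('n)\<close> is given by its total space, its projection, the fibrewise linear
  operations and a holomorphic atlas of local trivializations.  A pair \<open>(U, \<phi>)\<close> stands for the
  trivialization \<open>e \<mapsto> (proj e, \<phi> e)\<close> of the part of the bundle over \<open>U\<close>; the values of \<open>\<phi>\<close> are row
  vectors.  The vector space axioms in the fibres are transported from the model fibre by
  \<open>linear_triv\<close>, and the topology and complex structure of the total space are those determined by
  the atlas.
\<close>

record ('a, 'v, 'n) vbundle =
  total :: "'v set"
  proj :: "'v \<Rightarrow> 'a"
  vadd :: "'v \<Rightarrow> 'v \<Rightarrow> 'v"
  smul :: "complex \<Rightarrow> 'v \<Rightarrow> 'v"
  trivs :: "('a set \<times> ('v \<Rightarrow> complex ^ 'n)) set"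

definition fibre :: "('a, 'v, 'n::finite) vbundle \<Rightarrow> 'a \<Rightarrow> 'v set" where
  "fibre V x = {e \<in> total V. proj V e = x}"

definition linear_triv ::
  "('a, 'v, 'n::finite) vbundle \<Rightarrow> 'a set \<Rightarrow> ('v \<Rightarrow> complex ^ 'n) \<Rightarrow> bool" where
  "linear_triv V U \<phi> \<longleftrightarrow>
     (\<forall>x\<in>U. bij_betw \<phi> (fibre V x) UNIV \<and>
        (\<forall>e\<in>fibre V x. \<forall>e'\<in>fibre V x.
           vadd V e e' \<in> fibre V x \<and> \<phi> (vadd V e e') = \<phi> e + \<phi> e') \<and>
        (\<forall>c. \<forall>e\<in>fibre V x. smul V c e \<in> fibre V x \<and> \<phi> (smul V c e) = c *s \<phi> e))"

definition holo_transition ::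
  "'a surface \<Rightarrow> ('a, 'v, 'n::finite) vbundle \<Rightarrow> 'a set \<Rightarrow> ('v \<Rightarrow> complex ^ 'n)
     \<Rightarrow> 'a set \<Rightarrow> ('v \<Rightarrow> complex ^ 'n) \<Rightarrow> bool" where
  "holo_transition X V U \<phi> U' \<phi>' \<longleftrightarrow>
     (\<exists>g :: 'a \<Rightarrow> complex ^ 'n ^ 'n.
        (\<forall>i j. holo_on X (U \<inter> U') (\<lambda>x. g x $ i $ j)) \<and>
        (\<forall>x\<in>U \<inter> U'. invertible (g x) \<and> (\<forall>e\<in>fibre V x. \<phi> e = \<phi>' e v* g x)))"

definition holomorphic_vector_bundle ::
  "'a surface \<Rightarrow> ('a, 'v, 'n::finite) vbundle \<Rightarrow> bool" where
  "holomorphic_vector_bundle X V \<longleftrightarrow>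
     proj V ` total V = topspace (surf_top X) \<and>
     (\<Union>(U, \<phi>)\<in>trivs V. U) = topspace (surf_top X) \<and>
     (\<forall>(U, \<phi>)\<in>trivs V. openin (surf_top X) U \<and> linear_triv V U \<phi>) \<and>
     (\<forall>(U, \<phi>)\<in>trivs V. \<forall>(U', \<phi>')\<in>trivs V. holo_transition X V U \<phi> U' \<phi>')"

definition holo_triv ::
  "'a surface \<Rightarrow> ('a, 'v, 'n::finite) vbundle \<Rightarrow> 'a set \<Rightarrow> ('v \<Rightarrow> complex ^ 'n) \<Rightarrow> bool" where
  "holo_triv X V U \<phi> \<longleftrightarrow>
     openin (surf_top X) U \<and> linear_triv V U \<phi> \<and>
     (\<forall>(U', \<phi>')\<in>trivs V. holo_transition X V U \<phi> U' \<phi>')"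


section \<open>Projectively flat structures\<close>

definition projectively_flat_structure ::
  "'a surface \<Rightarrow> ('a, 'v, 'n::finite) vbundle \<Rightarrow> ('a set \<times> ('v \<Rightarrow> complex ^ 'n)) set \<Rightarrow> bool" where
  "projectively_flat_structure X V P \<longleftrightarrow>
     (\<Union>(U, \<phi>)\<in>P. U) = topspace (surf_top X) \<and>
     (\<forall>(U, \<phi>)\<in>P. holo_triv X V U \<phi>) \<and>
     (\<forall>(U, \<phi>)\<in>P. \<forall>(U', \<phi>')\<in>P.
        \<exists>(l :: 'a \<Rightarrow> complex) (T :: complex ^ 'n ^ 'n).
          holo_on X (U \<inter> U') l \<and> (\<forall>x\<in>U \<inter> U'. l x \<noteq> 0) \<and> invertible T \<and>
          (\<forall>x\<in>U \<inter> U'. \<forall>e\<in>fibre V x. \<phi> e = l x *s (\<phi>' e v* T)))"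

text \<open>Here the matrix factor is only locally constant, as \<open>U \<inter> U'\<close> may be disconnected.\<close>

definition pf_triv ::
  "'a surface \<Rightarrow> ('a, 'v, 'n::finite) vbundle \<Rightarrow> ('a set \<times> ('v \<Rightarrow> complex ^ 'n)) set
     \<Rightarrow> 'a set \<Rightarrow> ('v \<Rightarrow> complex ^ 'n) \<Rightarrow> bool" where
  "pf_triv X V P U \<phi> \<longleftrightarrow>
     holo_triv X V U \<phi> \<and>
     (\<forall>(U', \<phi>')\<in>P.
        \<exists>(l :: 'a \<Rightarrow> complex) (T :: 'a \<Rightarrow> complex ^ 'n ^ 'n).
          holo_on X (U \<inter> U') l \<and> (\<forall>x\<in>U \<inter> U'. l x \<noteq> 0) \<and> (\<forall>x\<in>U \<inter> U'. invertible (T x)) \<and>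
          (\<forall>x\<in>U \<inter> U'. \<exists>N. openin (surf_top X) N \<and> x \<in> N \<and> T constant_on (N \<inter> (U \<inter> U'))) \<and>
          (\<forall>x\<in>U \<inter> U'. \<forall>e\<in>fibre V x. \<phi> e = l x *s (\<phi>' e v* T x)))"


section \<open>Meromorphic sections of a bundle and of its endomorphism bundle\<close>

definition meromorphic_section ::
  "'a surface \<Rightarrow> ('a, 'v, 'n::finite) vbundle \<Rightarrow> ('a \<Rightarrow> 'v) \<Rightarrow> bool" where
  "meromorphic_section X V A \<longleftrightarrow>
     (\<forall>x\<in>topspace (surf_top X). A x \<in> fibre V x) \<and>
     (\<forall>U z \<phi>. coord_chart X U z \<longrightarrow> holo_triv X V U \<phi> \<longrightarrow>
        (\<forall>j. (\<lambda>t. \<phi> (A (inv_into U z t)) $ j) meromorphic_on (z ` U)))"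

definition scale_section ::
  "('a, 'v, 'n::finite) vbundle \<Rightarrow> ('a \<Rightarrow> complex) \<Rightarrow> ('a \<Rightarrow> 'v) \<Rightarrow> 'a \<Rightarrow> 'v" where
  "scale_section V f A = (\<lambda>x. smul V (f x) (A x))"

definition fibre_endo :: "('a, 'v, 'n::finite) vbundle \<Rightarrow> 'a \<Rightarrow> ('v \<Rightarrow> 'v) \<Rightarrow> bool" where
  "fibre_endo V x q \<longleftrightarrow>
     (\<forall>e\<in>fibre V x. q e \<in> fibre V x) \<and>
     (\<forall>e\<in>fibre V x. \<forall>e'\<in>fibre V x. q (vadd V e e') = vadd V (q e) (q e')) \<and>
     (\<forall>c. \<forall>e\<in>fibre V x. q (smul V c e) = smul V c (q e))"

definition matrix_of_endo ::
  "('a, 'v, 'n::finite) vbundle \<Rightarrow> ('v \<Rightarrow> complex ^ 'n) \<Rightarrow> 'a \<Rightarrow> ('v \<Rightarrow> 'v) \<Rightarrow> complex ^ 'n ^ 'n \<Rightarrow> bool"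
  where
  "matrix_of_endo V \<phi> x q M \<longleftrightarrow> (\<forall>e\<in>fibre V x. \<phi> (q e) = \<phi> e v* M)"

definition meromorphic_endo ::
  "'a surface \<Rightarrow> ('a, 'v, 'n::finite) vbundle \<Rightarrow> ('a \<Rightarrow> 'v \<Rightarrow> 'v) \<Rightarrow> bool" where
  "meromorphic_endo X V Q \<longleftrightarrow>
     (\<forall>x\<in>topspace (surf_top X). fibre_endo V x (Q x)) \<and>
     (\<forall>U z \<phi>. coord_chart X U z \<longrightarrow> holo_triv X V U \<phi> \<longrightarrow>
        (\<exists>M :: complex \<Rightarrow> complex ^ 'n ^ 'n.
           (\<forall>i j. (\<lambda>t. M t $ i $ j) meromorphic_on (z ` U)) \<and>
           (\<forall>x\<in>U. matrix_of_endo V \<phi> x (Q x) (M (z x)))))"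

definition endo_eq ::
  "'a surface \<Rightarrow> ('a, 'v, 'n::finite) vbundle \<Rightarrow> 'a set
     \<Rightarrow> ('a \<Rightarrow> 'v \<Rightarrow> 'v) \<Rightarrow> ('a \<Rightarrow> 'v \<Rightarrow> 'v) \<Rightarrow> bool" where
  "endo_eq X V S Q Q' \<longleftrightarrow> mero_ae X S (\<lambda>x. \<forall>e\<in>fibre V x. Q x e = Q' x e)"

text \<open>
  Endomorphisms are multiplied in the order of their matrices.  Since matrices act on row vectors
  from the right, the left factor is applied first.
\<close>

definition endo_mult :: "('a \<Rightarrow> 'v \<Rightarrow> 'v) \<Rightarrow> ('a \<Rightarrow> 'v \<Rightarrow> 'v) \<Rightarrow> 'a \<Rightarrow> 'v \<Rightarrow> 'v" where
  "endo_mult Q R = (\<lambda>x. R x \<circ> Q x)"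

definition endo_one :: "'a \<Rightarrow> 'v \<Rightarrow> 'v" where
  "endo_one = (\<lambda>x e. e)"


section \<open>Wronskians\<close>

text \<open>
  The index type is linearly ordered, so that \<open>card {k. k < i}\<close> is the position of row \<open>i\<close>, counted
  from \<open>0\<close>, and hence the order of derivative in that row.
\<close>

definition wronskian_matrix ::
  "'a set \<Rightarrow> ('a \<Rightarrow> complex) \<Rightarrow> ('v \<Rightarrow> complex ^ ('n::{finite, linorder})) \<Rightarrow> ('a \<Rightarrow> 'v) \<Rightarrow> complex
     \<Rightarrow> complex ^ ('n::{finite, linorder}) ^ ('n::{finite, linorder})" where
  "wronskian_matrix U z \<phi> A t =
     (\<chi> i j. (deriv ^^ card {k. k < i}) (\<lambda>s. \<phi> (A (inv_into U z s)) $ j) t)"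

definition wronskian ::
  "'a set \<Rightarrow> ('a \<Rightarrow> complex) \<Rightarrow> ('v \<Rightarrow> complex ^ ('n::{finite, linorder})) \<Rightarrow> ('a \<Rightarrow> 'v) \<Rightarrow> complex \<Rightarrow> complex"
  where
  "wronskian U z \<phi> A t = det (wronskian_matrix U z \<phi> A t)"

definition generic_section ::
  "'a surface \<Rightarrow> ('a, 'v, 'n::{finite, linorder}) vbundle \<Rightarrow> ('a set \<times> ('v \<Rightarrow> complex ^ ('n::{finite, linorder}))) set
     \<Rightarrow> ('a \<Rightarrow> 'v) \<Rightarrow> bool" where
  "generic_section X V P A \<longleftrightarrow>
     meromorphic_section X V A \<and>
     (\<exists>U z \<phi>. coord_chart X U z \<and> pf_triv X V P U \<phi> \<and>
        \<not> mero_ae X U (\<lambda>x. wronskian U z \<phi> A (z x) = 0))"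

definition wronskian_quotient_matrix ::
  "'a set \<Rightarrow> ('a \<Rightarrow> complex) \<Rightarrow> ('v \<Rightarrow> complex ^ ('n::{finite, linorder})) \<Rightarrow> ('a \<Rightarrow> 'v) \<Rightarrow> ('a \<Rightarrow> 'v) \<Rightarrow> complex
     \<Rightarrow> complex ^ ('n::{finite, linorder}) ^ ('n::{finite, linorder})" where
  "wronskian_quotient_matrix U z \<phi> A B t =
     matrix_inv (wronskian_matrix U z \<phi> B t) ** wronskian_matrix U z \<phi> A t"

text \<open>
  The endomorphism of the fibres over \<open>U\<close> that the quotient matrix defines through the chart \<open>z\<close> and
  the trivialization \<open>\<phi>\<close>.
\<close>

definition local_wronskian_quotient ::
  "('a, 'v, 'n::{finite, linorder}) vbundle \<Rightarrow> 'a set \<Rightarrow> ('a \<Rightarrow> complex) \<Rightarrow> ('v \<Rightarrow> complex ^ ('n::{finite, linorder}))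
     \<Rightarrow> ('a \<Rightarrow> 'v) \<Rightarrow> ('a \<Rightarrow> 'v) \<Rightarrow> 'a \<Rightarrow> 'v \<Rightarrow> 'v" where
  "local_wronskian_quotient V U z \<phi> A B x e =
     inv_into (fibre V x) \<phi> (\<phi> e v* wronskian_quotient_matrix U z \<phi> A B (z x))"

definition is_wronskian_quotient ::
  "'a surface \<Rightarrow> ('a, 'v, 'n::{finite, linorder}) vbundle \<Rightarrow> ('a set \<times> ('v \<Rightarrow> complex ^ ('n::{finite, linorder}))) set
     \<Rightarrow> ('a \<Rightarrow> 'v) \<Rightarrow> ('a \<Rightarrow> 'v) \<Rightarrow> ('a \<Rightarrow> 'v \<Rightarrow> 'v) \<Rightarrow> bool" where
  "is_wronskian_quotient X V P A B Q \<longleftrightarrow>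
     meromorphic_endo X V Q \<and>
     (\<forall>U z \<phi>. coord_chart X U z \<longrightarrow> pf_triv X V P U \<phi> \<longrightarrow>
        mero_ae X U (\<lambda>x. matrix_of_endo V \<phi> x (Q x) (wronskian_quotient_matrix U z \<phi> A B (z x))))"

text \<open>
  A representative of the Wronskian quotient \<open>A / B\<close>; meaningful once \<^const>\<open>is_wronskian_quotient\<close> is
  known to determine a section that exists and is unique up to \<^const>\<open>endo_eq\<close>.
\<close>

definition wronskian_quotient ::
  "'a surface \<Rightarrow> ('a, 'v, 'n::{finite, linorder}) vbundle \<Rightarrow> ('a set \<times> ('v \<Rightarrow> complex ^ ('n::{finite, linorder}))) set
     \<Rightarrow> ('a \<Rightarrow> 'v) \<Rightarrow> ('a \<Rightarrow> 'v) \<Rightarrow> 'a \<Rightarrow> 'v \<Rightarrow> 'v" where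
  "wronskian_quotient X V P A B = (SOME Q. is_wronskian_quotient X V P A B Q)"

end

theory Submission
  imports Defs
begin

text \<open>
  If \<open>b = l \<cdot> (a \<circ> h) M\<close> with a constant matrix \<open>M\<close>, then differentiating repeatedly gives
  \<open>W(b) = L (W(a) \<circ> h) M\<close> with \<open>L\<close> lower triangular, its diagonal consisting of the functions \<open>l h'\<^sup>k\<close>.
  As \<open>L\<close> depends only on \<open>l\<close> and \<open>h\<close>, it cancels in \<open>W(B)\<^sup>-\<^sup>1 W(A)\<close>, which is thereby conjugated by \<open>M\<close>.
  This covers both a change of chart and projectively flat trivialization and the scaling of
  \<open>A\<close> and \<open>B\<close> by a function \<open>l\<close> (with \<open>h = id\<close>, \<open>M = 1\<close>).  Near any point the determinant \<open>w(B)\<close>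
  either vanishes identically or has no zeros off the point; both alternatives are open, so by
  connectedness a generic section has \<open>w(B) \<noteq> 0\<close> off a closed discrete set on all of \<open>X\<close>.
\<close>

section \<open>Matrices\<close>

text \<open>The matrix \<open>M\<close> must be constant: derivatives of \<open>M\<close> would add
  terms that are no longer products with \<open>M\<close> on the right. The scalar \<open>l\<close>
  and the coordinate change \<open>h\<close> may vary, because they only combine derivatives of
  different orders, that is, rows. The cancellation needs one and the same \<open>L\<close> for
  \<open>A\<close> and \<open>B\<close>; therefore the transformation lemmas produce
  \<open>L\<close> before the section is fixed. The comparison is made at one point at a time, so no
  chart on an overlap, which may be disconnected, has to be chosen. A separate obstacle is that
  \<open>meromorphic_endo\<close> asks for a linear map in every fibre, including those over
  exceptional points, and for meromorphic matrices in every holomorphic trivialization. In a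
  trivialization that is not projectively flat there is no Wronskian formula for the matrix;
  meromorphy is carried over from a nearby projectively flat one by holomorphic transition
  matrices.\<close>

lemma matrix_inv_right: "invertible A \<Longrightarrow> A ** matrix_inv A = mat 1"
  and matrix_inv_left: "invertible A \<Longrightarrow> matrix_inv A ** A = mat 1"
  for A :: "'a::semiring_1 ^ 'n ^ 'm"
proof -
  assume "invertible A"
  then have "A ** matrix_inv A = mat 1 \<and> matrix_inv A ** A = mat 1"
    unfolding invertible_def matrix_inv_def by (rule someI_ex)
  then show "A ** matrix_inv A = mat 1" "matrix_inv A ** A = mat 1"
    by auto
qed

lemma matrix_inv_eqI:
  fixes A :: "'a::semiring_1 ^ 'n ^ 'm"
  assumes "A ** B = mat 1" "B ** A = mat 1"
  shows "matrix_inv A = B"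
proof -
  have "invertible A"
    using assms by (auto simp: invertible_def)
  then have "matrix_inv A = matrix_inv A ** (A ** B)"
    by (simp add: assms)
  also have "\<dots> = B"
    by (simp add: matrix_mul_assoc matrix_inv_left \<open>invertible A\<close>)
  finally show ?thesis .
qed

lemma invertible_matrix_inv: "invertible A \<Longrightarrow> invertible (matrix_inv A)"
  for A :: "'a::semiring_1 ^ 'n ^ 'm"
  using matrix_inv_right matrix_inv_left unfolding invertible_def by blast

lemma matrix_inv_mult:
  fixes A B :: "'a::semiring_1 ^ 'n ^ 'n"
  assumes "invertible A" "invertible B"
  shows "matrix_inv (A ** B) = matrix_inv B ** matrix_inv A"
proof (rule matrix_inv_eqI)
  have "A ** B ** (matrix_inv B ** matrix_inv A) = A ** (B ** matrix_inv B) ** matrix_inv A"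
    by (simp add: matrix_mul_assoc)
  then show "A ** B ** (matrix_inv B ** matrix_inv A) = mat 1"
    by (simp add: assms matrix_inv_right)
  have "matrix_inv B ** matrix_inv A ** (A ** B) = matrix_inv B ** (matrix_inv A ** A) ** B"
    by (simp add: matrix_mul_assoc)
  then show "matrix_inv B ** matrix_inv A ** (A ** B) = mat 1"
    by (simp add: assms matrix_inv_left)
qed

text \<open>Cramer's rule for the \<open>j\<close>-th column of the identity. Written as a ratio of
  determinants, an entry of the inverse is visibly meromorphic when the entries of the matrix
  are.\<close>

lemma matrix_inv_component:
  fixes A :: "'a::field ^ 'n ^ 'n"
  assumes "invertible A"
  shows "matrix_inv A $ k $ j
    = det (\<chi> i m. if m = k then (if i = j then 1 else 0) else A $ i $ m) / det A"
proof -
  have "A *v column j (matrix_inv A) = column j (mat 1)"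
    by (simp add: matrix_inv_right[OF assms, symmetric] vec_eq_iff column_def
        matrix_matrix_mult_def matrix_vector_mult_def)
  then have "column j (matrix_inv A)
    = (\<chi> k. det (\<chi> i m. if m = k then column j (mat 1) $ i else A $ i $ m) / det A)"
    using assms cramer invertible_det_nz by blast
  from arg_cong[OF this, of "\<lambda>v. v $ k"] show ?thesis
    by (simp add: column_def mat_def cong: if_cong)
qed

text \<open>The kernel is trivial: if \<open>i\<close> is the least index at which a kernel vector
  is nonzero, then in row \<open>i\<close> the earlier terms vanish by minimality and the later ones
  by triangularity, leaving a nonzero diagonal term.\<close>

lemma invertible_lower_triangular:
  fixes A :: "'a::field ^ ('n::{finite, linorder}) ^ ('n::{finite, linorder})"
  assumes "\<And>i j. i < j \<Longrightarrow> A $ i $ j = 0" "\<And>i. A $ i $ i \<noteq> 0"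
  shows "invertible A"
proof -
  have "x = 0" if "A *v x = 0" for x
  proof (rule ccontr)
    assume "x \<noteq> 0"
    define i where "i = Min {i. x $ i \<noteq> 0}"
    have ne: "{i. x $ i \<noteq> 0} \<noteq> {}"
      using \<open>x \<noteq> 0\<close> by (auto simp: vec_eq_iff)
    have i: "x $ i \<noteq> 0"
      using Min_in[OF _ ne] by (simp add: i_def)
    have "x $ j = 0" if "j < i" for j
      using Min_le[of "{i. x $ i \<noteq> 0}" j] that unfolding i_def
      by (metis (mono_tags) finite leD mem_Collect_eq)
    then have "A $ i $ j * x $ j = 0" if "j \<noteq> i" for j
      using that assms(1)[of i j] by (cases j i rule: linorder_cases) auto
    then have "(A *v x) $ i = A $ i $ i * x $ i"
      by (simp add: matrix_vector_mult_def sum.remove[of UNIV i] sum.neutral)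
    with that i assms(2)[of i] show False
      by simp
  qed
  then show ?thesis
    using matrix_left_invertible_ker invertible_left_inverse by blast
qed

lemma vector_matrix_axis: "(axis i 1 v* A) $ j = A $ i $ j"
  for A :: "'a::semiring_1 ^ 'n ^ 'm"
proof -
  have "(axis i 1 v* A) $ j = (\<Sum>k\<in>UNIV. if k = i then A $ k $ j else 0)"
    by (auto simp: vector_matrix_mult_def axis_def if_distrib if_distribR cong: if_cong)
  then show ?thesis
    by simp
qed

lemma matrix_eq_if_vector_matrix_eq:
  fixes A B :: "'a::semiring_1 ^ 'n ^ 'm"
  assumes "\<And>v. v v* A = v v* B"
  shows "A = B"
proof -
  have "A $ i $ j = B $ i $ j" for i j
    using assms[of "axis i 1"] vector_matrix_axis[of i A j] vector_matrix_axis[of i B j] by simp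
  then show ?thesis
    by (simp add: vec_eq_iff)
qed

text \<open>Allows a sum over orders of differentiation to be rewritten as a sum over row indices,
  as a matrix product requires.\<close>

lemma card_less_bij:
  "bij_betw (\<lambda>i::'n::{finite, linorder}. card {k. k < i}) UNIV {..<CARD('n)}"
proof -
  have mono: "card {k. k < i} < card {k. k < j}" if "i < j" for i j :: 'n
    using that by (intro psubset_card_mono) (auto intro: less_trans)
  then have inj: "inj (\<lambda>i::'n. card {k. k < i})"
    by (intro injI) (metis linorder_cases less_irrefl)
  have "(\<lambda>i::'n. card {k. k < i}) ` UNIV \<subseteq> {..<CARD('n)}"
    by (auto intro!: psubset_card_mono)
  then have "(\<lambda>i::'n. card {k. k < i}) ` UNIV = {..<CARD('n)}"
    using card_image[OF inj] by (intro card_subset_eq) auto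
  with inj show ?thesis
    by (simp add: bij_betw_def)
qed


section \<open>Change of variable in a Wronskian\<close>

text \<open>
  The \<open>k\<close>-th derivative of \<open>l \<cdot> (f \<circ> h)\<close> is a combination of the functions \<open>f\<^sup>(\<^sup>m\<^sup>) \<circ> h\<close>, \<open>m \<le> k\<close>, whose
  coefficients do not depend on \<open>f\<close>.
\<close>

primrec chain_coeff ::
  "(complex \<Rightarrow> complex) \<Rightarrow> (complex \<Rightarrow> complex) \<Rightarrow> nat \<Rightarrow> nat \<Rightarrow> complex \<Rightarrow> complex" where
  "chain_coeff l h 0 = (\<lambda>m. if m = 0 then l else (\<lambda>_. 0))"
| "chain_coeff l h (Suc k) = (\<lambda>m t. deriv (chain_coeff l h k m) t
     + (if m = 0 then 0 else chain_coeff l h k (m - 1) t * deriv h t))"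

lemma chain_coeff_eq_0: "k < m \<Longrightarrow> chain_coeff l h k m = (\<lambda>_. 0)"
  by (induction k arbitrary: m) auto

lemma chain_coeff_diag: "chain_coeff l h k k t = l t * deriv h t ^ k"
  by (induction k) (auto simp: chain_coeff_eq_0)

lemma chain_coeff_holomorphic:
  assumes "open S" "l holomorphic_on S" "h holomorphic_on S"
  shows "chain_coeff l h k m holomorphic_on S"
proof (induction k arbitrary: m)
  case 0
  then show ?case
    using assms by auto
next
  case (Suc k)
  show ?case
    using Suc[of m] Suc[of "m - 1"] assms
    by (cases "m = 0") (auto intro!: holomorphic_intros)
qed

text \<open>Induction on \<open>k\<close> differentiates the identity of the previous order, so it
  has to hold on an open set and not merely at one point; the pointwise version is derived
  afterwards.\<close>

lemma higher_deriv_mult_compose_on: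
  assumes S: "open S" "l holomorphic_on S" "h holomorphic_on S"
    and f: "f analytic_on h ` S" and "t \<in> S"
  shows "(deriv ^^ k) (\<lambda>s. l s * f (h s)) t
    = (\<Sum>m\<le>k. chain_coeff l h k m t * (deriv ^^ m) f (h t))"
  using \<open>t \<in> S\<close>
proof (induction k arbitrary: t)
  case 0
  then show ?case
    by simp
next
  case (Suc k)
  let ?c = "chain_coeff l h k" and ?F = "\<lambda>m t. (deriv ^^ m) f (h t)"
  have dh: "(h has_field_derivative deriv h t) (at t)"
    using S Suc.prems holomorphic_derivI by blast
  have dc: "(?c m has_field_derivative deriv (?c m) t) (at t)" for m
    using chain_coeff_holomorphic[OF S] S(1) Suc.prems holomorphic_derivI by blast
  have dF: "(?F m has_field_derivative ?F (Suc m) t * deriv h t) (at t)" for m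
  proof -
    have "(deriv ^^ m) f analytic_on {h t}"
      using f Suc.prems by (intro analytic_higher_deriv) (auto intro: analytic_on_subset)
    then have "((deriv ^^ m) f has_field_derivative ?F (Suc m) t) (at (h t))"
      by (simp add: analytic_on_imp_differentiable_at DERIV_deriv_iff_field_differentiable)
    from DERIV_chain2[OF this dh] show ?thesis .
  qed
  have "((\<lambda>t. \<Sum>m\<le>k. ?c m t * ?F m t) has_field_derivative
      (\<Sum>m\<le>k. deriv (?c m) t * ?F m t + ?F (Suc m) t * deriv h t * ?c m t)) (at t)"
    by (intro DERIV_sum DERIV_mult dc dF)
  moreover have "\<forall>\<^sub>F s in nhds t. (deriv ^^ k) (\<lambda>s. l s * f (h s)) s = (\<Sum>m\<le>k. ?c m s * ?F m s)"
    using eventually_nhds_in_open[OF S(1) Suc.prems] by eventually_elim (rule Suc.IH)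
  ultimately have "(deriv ^^ Suc k) (\<lambda>s. l s * f (h s)) t
      = (\<Sum>m\<le>k. deriv (?c m) t * ?F m t + ?F (Suc m) t * deriv h t * ?c m t)"
    by (simp add: deriv_cong_ev DERIV_imp_deriv)
  \<comment> \<open>The term \<open>m = Suc k\<close> can be included because the coefficient of
    order \<open>Suc k\<close> is identically \<open>0\<close> at stage \<open>k\<close>.\<close>
  also have "\<dots> = (\<Sum>m\<le>Suc k. deriv (?c m) t * ?F m t) + (\<Sum>m\<le>k. ?c m t * deriv h t * ?F (Suc m) t)"
    by (simp add: chain_coeff_eq_0 sum.distrib mult_ac del: funpow.simps)
  \<comment> \<open>Shifting \<open>m\<close> by one produces the second summand in the recursion
    for \<open>chain_coeff\<close>.\<close>
  also have "(\<Sum>m\<le>k. ?c m t * deriv h t * ?F (Suc m) t)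
      = (\<Sum>m\<le>Suc k. (if m = 0 then 0 else ?c (m - 1) t * deriv h t) * ?F m t)"
    by (subst sum.atMost_Suc_shift) simp
  finally show ?case
    by (simp add: sum.distrib ring_distribs del: funpow.simps sum.atMost_Suc)
qed

lemma higher_deriv_mult_compose:
  assumes "l analytic_on {t}" "h analytic_on {t}" "f analytic_on {h t}"
  shows "(deriv ^^ k) (\<lambda>s. l s * f (h s)) t
    = (\<Sum>m\<le>k. chain_coeff l h k m t * (deriv ^^ m) f (h t))"
proof -
  obtain S where S: "open S" "t \<in> S" "l holomorphic_on S" "h holomorphic_on S"
    using assms(1,2) analytic_at_two by metis
  obtain R where R: "open R" "h t \<in> R" "f holomorphic_on R"
    using assms(3) analytic_at by metis
  have "open (S \<inter> h -` R)"
    using S R by (intro continuous_open_preimage holomorphic_on_imp_continuous_on)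
  moreover have "f analytic_on h ` (S \<inter> h -` R)"
    using R analytic_on_open[OF R(1), of f] by (auto intro: analytic_on_subset)
  ultimately show ?thesis
    using S R by (intro higher_deriv_mult_compose_on[of "S \<inter> h -` R"])
      (auto intro: holomorphic_on_subset)
qed

text \<open>The constancy of the matrix factor enters here: its entries are the numbers
  \<open>c i\<close>, which differentiation leaves alone.\<close>

lemma higher_deriv_sum_cmult:
  assumes "\<And>i. i \<in> I \<Longrightarrow> f i analytic_on {t}"
  shows "(deriv ^^ k) (\<lambda>s. \<Sum>i\<in>I. f i s * c i) t = (\<Sum>i\<in>I. (deriv ^^ k) (f i) t * c i)"
  using assms
proof (induction I rule: infinite_finite_induct)
  case (insert i I)
  have "(\<lambda>s. f i s * c i) analytic_on {t}" "(\<lambda>s. \<Sum>i\<in>I. f i s * c i) analytic_on {t}"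
    using insert.prems by (auto intro!: analytic_intros)
  then have "(deriv ^^ k) (\<lambda>s. f i s * c i + (\<Sum>i\<in>I. f i s * c i)) t
      = (deriv ^^ k) (\<lambda>s. c i * f i s) t + (deriv ^^ k) (\<lambda>s. \<Sum>i\<in>I. f i s * c i) t"
    by (simp add: higher_deriv_add_at mult.commute)
  also have "(deriv ^^ k) (\<lambda>s. c i * f i s) t = (deriv ^^ k) (f i) t * c i"
    using insert.prems by (subst higher_deriv_cmult') auto
  finally show ?case
    using insert by simp
qed auto

text \<open>The Wronskian matrix freed from bundle and chart, so that the transformation law becomes
  a statement about functions of one complex variable.\<close>

definition wronski ::
  "(complex \<Rightarrow> complex ^ ('n::{finite, linorder})) \<Rightarrow> complex
     \<Rightarrow> complex ^ ('n::{finite, linorder}) ^ ('n::{finite, linorder})" where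
  "wronski a t = (\<chi> i j. (deriv ^^ card {k. k < i}) (\<lambda>s. a s $ j) t)"

text \<open>The order of quantifiers carries the content: \<open>L\<close> is built from
  \<open>l\<close>, \<open>h\<close> and \<open>t\<close> alone and serves all \<open>a\<close>,
  \<open>b\<close> and \<open>M\<close>. The relation between \<open>a\<close> and \<open>b\<close>
  is required near \<open>t\<close>, not just at \<open>t\<close>, because it is
  differentiated.\<close>

lemma wronski_transform:
  fixes l h :: "complex \<Rightarrow> complex"
  assumes l: "l analytic_on {t}" "l t \<noteq> 0" and h: "h analytic_on {t}" "deriv h t \<noteq> 0"
  obtains L :: "complex ^ ('n::{finite, linorder}) ^ ('n::{finite, linorder})" where "invertible L"
    and "\<forall>a b M. (\<forall>j. (\<lambda>s. a s $ j) analytic_on {h t}) \<longrightarrow>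
      (\<forall>\<^sub>F s in nhds t. b s = l s *s (a (h s) v* M)) \<longrightarrow> wronski b t = L ** wronski a (h t) ** M"
proof (rule that, safe)
  let ?p = "\<lambda>i::'n. card {k. k < i}"
  let ?L = "(\<chi> i j. chain_coeff l h (?p i) (?p j) t) :: complex ^ ('n::{finite, linorder}) ^ ('n::{finite, linorder})"
  \<comment> \<open>A larger index means a higher order, so entries of \<open>?L\<close> above the
    diagonal are coefficients of derivatives that do not occur.\<close>
  have "?p i < ?p j" if "i < j" for i j
    using that by (intro psubset_card_mono) (auto intro: less_trans)
  then show "invertible ?L"
    using l h by (intro invertible_lower_triangular) (auto simp: chain_coeff_eq_0 chain_coeff_diag)
  fix a b :: "complex \<Rightarrow> complex ^ ('n::{finite, linorder})" and M :: "complex ^ ('n::{finite, linorder}) ^ ('n::{finite, linorder})"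
  assume a: "\<forall>j. (\<lambda>s. a s $ j) analytic_on {h t}"
    and b: "\<forall>\<^sub>F s in nhds t. b s = l s *s (a (h s) v* M)"
  have "wronski b t $ i $ j = (?L ** (wronski a (h t) ** M)) $ i $ j" for i j
  proof -
    let ?f = "\<lambda>u. \<Sum>k\<in>UNIV. a u $ k * M $ k $ j"
    have f: "?f analytic_on {h t}"
      using a by (auto intro!: analytic_intros)
    have F: "(deriv ^^ m) ?f (h t) = (\<Sum>k\<in>UNIV. (deriv ^^ m) (\<lambda>s. a s $ k) (h t) * M $ k $ j)" for m
      by (intro higher_deriv_sum_cmult) (use a in blast)
    have "wronski b t $ i $ j = (deriv ^^ ?p i) (\<lambda>s. b s $ j) t"
      by (simp add: wronski_def)
    also have "\<dots> = (deriv ^^ ?p i) (\<lambda>s. l s * ?f (h s)) t"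
      using b by (intro higher_deriv_cong_ev refl) (auto elim!: eventually_mono simp: vector_matrix_mult_def)
    also have "\<dots> = (\<Sum>m\<le>?p i. chain_coeff l h (?p i) m t * (deriv ^^ m) ?f (h t))"
      by (intro higher_deriv_mult_compose l h f)
    \<comment> \<open>The added coefficients, those of order above \<open>?p i\<close>, are zero;
      the range now matches all rows of the matrix.\<close>
    also have "\<dots> = (\<Sum>m<CARD('n). chain_coeff l h (?p i) m t * (deriv ^^ m) ?f (h t))"
      using bij_betw_apply[OF card_less_bij, of i]
      by (intro sum.mono_neutral_left) (auto simp: chain_coeff_eq_0)
    also have "\<dots> = (\<Sum>k\<in>UNIV. chain_coeff l h (?p i) (?p k) t * (deriv ^^ ?p k) ?f (h t))"
      by (rule sum.reindex_bij_betw[OF card_less_bij, symmetric])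
    also have "\<dots> = (?L ** (wronski a (h t) ** M)) $ i $ j"
      by (simp add: F matrix_matrix_mult_def wronski_def)
    finally show ?thesis .
  qed
  then show "wronski b t = ?L ** wronski a (h t) ** M"
    by (simp add: vec_eq_iff matrix_mul_assoc)
qed

lemma analytic_scale_compose:
  fixes a :: "complex \<Rightarrow> complex ^ 'm" and b :: "complex \<Rightarrow> complex ^ 'k" and M :: "complex ^ 'k ^ 'm"
  assumes "l analytic_on {t}" "h analytic_on {t}" "\<And>k. (\<lambda>s. a s $ k) analytic_on {h t}"
    and b: "\<forall>\<^sub>F s in nhds t. b s = l s *s (a (h s) v* M)"
  shows "(\<lambda>s. b s $ j) analytic_on {t}"
proof -
  have "(\<lambda>s. a (h s) $ k) analytic_on {t}" for k
    using analytic_on_compose[of h "{t}" "\<lambda>s. a s $ k"] assms by (simp add: o_def)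
  then have "(\<lambda>s. l s * (\<Sum>k\<in>UNIV. a (h s) $ k * M $ k $ j)) analytic_on {t}"
    using assms(1) by (auto intro!: analytic_intros)
  moreover have "\<forall>\<^sub>F s in nhds t. l s * (\<Sum>k\<in>UNIV. a (h s) $ k * M $ k $ j) = b s $ j"
    using b by eventually_elim (simp add: vector_matrix_mult_def)
  ultimately show ?thesis
    by (simp add: analytic_at_cong)
qed


section \<open>Meromorphic functions and matrices\<close>

lemma eventually_nhds_at: "eventually R (nhds x) \<Longrightarrow> eventually R (at x)"
  by (auto simp: eventually_at_filter elim: eventually_mono)

lemma meromorphic_eventually_analytic:
  assumes "f meromorphic_on {t}"
  shows "\<forall>\<^sub>F s in at t. f analytic_on {s}"
proof -
  have "\<not> t islimpt {s. \<not> f analytic_on {s}}"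
    using meromorphic_on_imp_not_islimpt_singularities[OF assms] by simp
  then show ?thesis
    by (simp add: islimpt_iff_eventually)
qed

text \<open>Zeros accumulating at \<open>t\<close> force a meromorphic germ to vanish. This is the
  local source of both dichotomies used later, for functions and for Wronskian determinants.\<close>

lemma meromorphic_eventually_zero_or_nonzero:
  assumes "f meromorphic_on {t}"
  shows "(\<forall>\<^sub>F s in at t. f s = 0) \<or> (\<forall>\<^sub>F s in at t. f s \<noteq> 0)"
  using not_essential_frequently_0_imp_eventually_0[of f t] assms
  by (auto simp: meromorphic_at_iff frequently_def)

lemma meromorphic_det:
  fixes M :: "complex \<Rightarrow> complex ^ 'n ^ 'n"
  assumes "\<And>i j. (\<lambda>t. M t $ i $ j) meromorphic_on S"
  shows "(\<lambda>t. det (M t)) meromorphic_on S"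
  unfolding det_def using assms by (intro meromorphic_intros)

lemma meromorphic_matrix_mult:
  fixes M :: "complex \<Rightarrow> complex ^ 'n ^ 'm" and N :: "complex \<Rightarrow> complex ^ 'k ^ 'n"
  assumes "\<And>i j. (\<lambda>t. M t $ i $ j) meromorphic_on S" "\<And>i j. (\<lambda>t. N t $ i $ j) meromorphic_on S"
  shows "(\<lambda>t. (M t ** N t) $ i $ j) meromorphic_on S"
  unfolding matrix_matrix_mult_def using assms by (auto intro!: meromorphic_intros)

text \<open>Cramer's formula is needed only on a punctured neighbourhood, since meromorphy ignores
  the value at \<open>t0\<close>; hence invertibility is assumed only there.\<close>

lemma meromorphic_matrix_inv:
  fixes M :: "complex \<Rightarrow> complex ^ 'n ^ 'n"
  assumes M: "\<And>i j. (\<lambda>t. M t $ i $ j) meromorphic_on {t0}"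
    and inv: "\<forall>\<^sub>F t in at t0. invertible (M t)"
  shows "(\<lambda>t. matrix_inv (M t) $ k $ j) meromorphic_on {t0}"
proof -
  have "(\<lambda>t. (\<chi> i m. if m = k then (if i = j then 1 else 0) else M t $ i $ m) $ i' $ j')
      meromorphic_on {t0}" for i' j'
    using M by (cases "j' = k") auto
  then have "(\<lambda>t. det (\<chi> i m. if m = k then (if i = j then 1 else 0) else M t $ i $ m) / det (M t))
      meromorphic_on {t0}"
    using M by (intro meromorphic_intros meromorphic_det)
  moreover have "\<forall>\<^sub>F t in at t0. det (\<chi> i m. if m = k then (if i = j then 1 else 0) else M t $ i $ m)
      / det (M t) = matrix_inv (M t) $ k $ j"
    using inv by eventually_elim (simp add: matrix_inv_component)
  ultimately show ?thesis
    by (subst meromorphic_on_cong[OF _ refl, symmetric]) auto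
qed


section \<open>Charts\<close>

lemma complex_chart_subset_topspace: "complex_chart T U z \<Longrightarrow> U \<subseteq> topspace T"
  by (auto simp: complex_chart_def dest: openin_subset)

lemma complex_chart_inj: "complex_chart T U z \<Longrightarrow> inj_on z U"
  using homeomorphic_imp_injective_map[of "subtopology T U" "top_of_set (z ` U)" z] complex_chart_subset_topspace[of T U z]
  by (simp add: complex_chart_def Int_absorb1)

lemma complex_chart_open_image:
  assumes "complex_chart T U z" "W \<subseteq> U"
  shows "open (z ` W) \<longleftrightarrow> openin T W"
proof -
  have U: "openin T U" "open (z ` U)" "homeomorphic_map (subtopology T U) (top_of_set (z ` U)) z"
    using assms by (auto simp: complex_chart_def)
  then have "openin (top_of_set (z ` U)) (z ` W) \<longleftrightarrow> openin (subtopology T U) W"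
    using assms complex_chart_subset_topspace by (intro homeomorphic_map_openness) fastforce+
  with U assms show ?thesis
    by (auto simp: openin_open_eq openin_open_subtopology)
qed

lemma complex_chart_connected_image:
  assumes "complex_chart T U z" "W \<subseteq> U"
  shows "connected (z ` W) \<longleftrightarrow> connectedin T W"
proof -
  have "connectedin (top_of_set (z ` U)) (z ` W) \<longleftrightarrow> connectedin (subtopology T U) W"
    using assms complex_chart_subset_topspace
    by (intro homeomorphic_map_connectedness) (fastforce simp: complex_chart_def)+
  with assms(2) show ?thesis
    by (auto simp: connectedin_subtopology)
qed

lemma complex_chart_subset:
  assumes "complex_chart T U z" "openin T W" "W \<subseteq> U"
  shows "complex_chart T W z"
proof -
  have "homeomorphic_map (subtopology (subtopology T U) W) (subtopology (top_of_set (z ` U)) (z ` W)) z"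
    by (rule homeomorphic_map_subtopologies)
      (use assms openin_subset[OF assms(2)] in \<open>auto simp: complex_chart_def\<close>)
  moreover have "U \<inter> W = W" "z ` U \<inter> z ` W = z ` W"
    using assms(3) by auto
  ultimately show ?thesis
    using assms complex_chart_open_image[OF assms(1,3)]
    by (simp add: complex_chart_def subtopology_subtopology)
qed

lemma eventually_inv_into_chart:
  assumes "complex_chart T U z" "openin T W" "x \<in> U" "x \<in> W"
  shows "\<forall>\<^sub>F t in nhds (z x). inv_into U z t \<in> U \<and> inv_into U z t \<in> W \<and> z (inv_into U z t) = t"
proof -
  have "open (z ` (U \<inter> W))"
    using assms complex_chart_open_image[of T U z "U \<inter> W"] by (auto simp: complex_chart_def)
  then have "\<forall>\<^sub>F t in nhds (z x). t \<in> z ` (U \<inter> W)"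
    using assms by (intro eventually_nhds_in_open) auto
  then show ?thesis
    by eventually_elim (use complex_chart_inj[OF assms(1)] in auto)
qed

text \<open>A chart is a homeomorphism onto an open set, so punctured neighbourhoods correspond.
  This converts \<open>mero_ae\<close> statements on the surface into statements about functions of
  a complex variable, and back.\<close>

lemma eventually_chart:
  assumes "complex_chart T U z" "x \<in> U"
  shows "(\<forall>\<^sub>F y in atin T x. R y) \<longleftrightarrow> (\<forall>\<^sub>F t in at (z x). R (inv_into U z t))"
proof
  have x: "x \<in> topspace T"
    using assms complex_chart_subset_topspace by fastforce
  note inj = complex_chart_inj[OF assms(1)]
  show "\<forall>\<^sub>F t in at (z x). R (inv_into U z t)" if "\<forall>\<^sub>F y in atin T x. R y"
  proof -
    obtain W where W: "openin T W" "x \<in> W" "\<And>y. y \<in> W - {x} \<Longrightarrow> R y"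
      using \<open>\<forall>\<^sub>F y in atin T x. R y\<close> x by (auto simp: eventually_atin)
    have "\<forall>\<^sub>F t in nhds (z x). t \<noteq> z x \<longrightarrow> R (inv_into U z t)"
      using eventually_inv_into_chart[OF assms(1) W(1) assms(2) W(2)]
      by eventually_elim (use W(3) in force)
    then show ?thesis
      by (simp add: eventually_at_filter)
  qed
  show "\<forall>\<^sub>F y in atin T x. R y" if R: "\<forall>\<^sub>F t in at (z x). R (inv_into U z t)"
  proof -
    obtain S where S: "open S" "z x \<in> S" "\<forall>t\<in>S. t \<noteq> z x \<longrightarrow> R (inv_into U z t)"
      using R by (auto simp: eventually_at_topological)
    let ?W = "{y \<in> U. z y \<in> S}"
    have "z ` ?W = z ` U \<inter> S"
      by auto
    then have "openin T ?W"
      using S assms complex_chart_open_image[of T U z ?W] by (auto simp: complex_chart_def)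
    moreover have "R y" if "y \<in> ?W - {x}" for y
      using bspec[OF S(3), of "z y"] that inj assms(2) by (auto simp: inj_on_eq_iff)
    ultimately show ?thesis
      unfolding eventually_atin using S assms by blast
  qed
qed

section \<open>Punctured neighbourhoods and propagation by connectedness\<close>

lemma atin_chart_neq_bot:
  assumes "complex_chart T U z" "x \<in> U"
  shows "atin T x \<noteq> bot"
  using eventually_chart[OF assms, of "\<lambda>_. False"] by (metis at_neq_bot eventually_False)

lemma openin_eventually_atin:
  assumes "\<And>x. x \<in> topspace T \<Longrightarrow> R x \<Longrightarrow> \<forall>\<^sub>F y in atin T x. R y"
  shows "openin T {x \<in> topspace T. R x}"
proof (subst openin_subopen, safe)
  fix x assume x: "x \<in> topspace T" "R x"
  then obtain W where "openin T W" "x \<in> W" "\<And>y. y \<in> W - {x} \<Longrightarrow> R y"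
    using assms[OF x] by (auto simp: eventually_atin)
  with x show "\<exists>W. openin T W \<and> x \<in> W \<and> W \<subseteq> {x \<in> topspace T. R x}"
    by (intro exI[of _ W]) (auto dest: openin_subset)
qed

text \<open>In a T1 space \<open>W - {x}\<close> is open, so it is a neighbourhood of each of its
  points on which \<open>R\<close> holds throughout.\<close>

lemma eventually_eventually_atin:
  assumes "\<forall>\<^sub>F y in atin T x. R y" "t1_space T"
  shows "\<forall>\<^sub>F y in atin T x. \<forall>\<^sub>F w in atin T y. R w"
proof (cases "x \<in> topspace T")
  case True
  then obtain W where W: "openin T W" "x \<in> W" "\<And>y. y \<in> W - {x} \<Longrightarrow> R y"
    using assms(1) by (auto simp: eventually_atin)
  have "openin T (W - {x})"
    using W assms(2) True by (intro openin_diff) (auto simp: t1_space_closedin_singleton)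
  then have "\<forall>\<^sub>F w in atin T y. R w" if "y \<in> W - {x}" for y
    using that W(3) unfolding eventually_atin by blast
  with W show ?thesis
    unfolding eventually_atin by blast
qed (simp add: eventually_atin)

text \<open>Both alternatives are open conditions on \<open>x\<close>, so one of them holds throughout.\<close>

lemma connected_space_eventually_dichotomy:
  assumes "connected_space T" "t1_space T"
    and "\<And>x. x \<in> topspace T \<Longrightarrow> atin T x \<noteq> bot"
    and dich: "\<And>x. x \<in> topspace T \<Longrightarrow> (\<forall>\<^sub>F y in atin T x. R y) \<or> (\<forall>\<^sub>F y in atin T x. \<not> R y)"
    and x: "x \<in> topspace T" "\<not> (\<forall>\<^sub>F y in atin T x. \<not> R y)"
    and y: "y \<in> topspace T"
  shows "\<forall>\<^sub>F w in atin T y. R w"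
proof -
  let ?E = "\<lambda>x. \<forall>\<^sub>F y in atin T x. R y" and ?N = "\<lambda>x. \<forall>\<^sub>F y in atin T x. \<not> R y"
  let ?A = "{x \<in> topspace T. ?E x}"
  have "openin T ?A" "openin T {x \<in> topspace T. ?N x}"
    by (intro openin_eventually_atin eventually_eventually_atin assms; assumption)+
  \<comment> \<open>No point is isolated, so \<open>R\<close> and its negation cannot both hold near
    \<open>x\<close>; the two open sets are therefore complementary.\<close>
  moreover have "\<not> (?E x \<and> ?N x)" if "x \<in> topspace T" for x
    using assms(3)[OF that] eventually_conj[of R "atin T x" "\<lambda>x. \<not> R x"]
    by (auto simp: eventually_False)
  then have "topspace T - ?A = {x \<in> topspace T. ?N x}"
    using dich by auto
  ultimately have "openin T ?A" "closedin T ?A"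
    by (auto simp: closedin_def)
  then have "?A = {} \<or> ?A = topspace T"
    using assms(1) unfolding connected_space_clopen_in by blast
  with x y dich[OF x(1)] show ?thesis
    by blast
qed

text \<open>A \<open>coord_chart\<close> without connectedness: charts of the atlas need not be
  connected, nor need restrictions of a chart to open subsets.\<close>

definition compatible_chart :: "'a surface \<Rightarrow> 'a set \<Rightarrow> ('a \<Rightarrow> complex) \<Rightarrow> bool" where
  "compatible_chart X U z \<longleftrightarrow> complex_chart (surf_top X) U z \<and>
     (\<forall>(U', z')\<in>surf_atlas X. holo_change U z U' z' \<and> holo_change U' z' U z)"

lemma coord_chart_iff:
  "coord_chart X U z \<longleftrightarrow> connectedin (surf_top X) U \<and> compatible_chart X U z"
  by (simp add: coord_chart_def compatible_chart_def)

lemma compatible_chart_complex_chart: "compatible_chart X U z \<Longrightarrow> complex_chart (surf_top X) U z"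
  by (simp add: compatible_chart_def)

lemma inv_into_subset:
  assumes "inj_on f B" "A \<subseteq> B" "y \<in> f ` A"
  shows "inv_into A f y = inv_into B f y"
  using assms by (metis f_inv_into_f inv_into_f_f inv_into_into subsetD)

lemma holo_change_subset:
  assumes "holo_change U z U' z'" "inj_on z U" "W \<subseteq> U" "W' \<subseteq> U'"
  shows "holo_change W z W' z'"
proof -
  have "(z' \<circ> inv_into U z) holomorphic_on (z ` (W \<inter> W'))"
    using assms unfolding holo_change_def by (elim holomorphic_on_subset) auto
  moreover have "(z' \<circ> inv_into U z) t = (z' \<circ> inv_into W z) t" if "t \<in> z ` (W \<inter> W')" for t
    using inv_into_subset[OF assms(2,3), of t] that by auto
  ultimately show ?thesis
    unfolding holo_change_def by (metis holomorphic_cong)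
qed

lemma holo_on_subset: "holo_on X S f \<Longrightarrow> W \<subseteq> S \<Longrightarrow> holo_on X W f"
  unfolding holo_on_def
  by (clarify, drule (1) bspec, clarify, erule holomorphic_on_subset, blast)

section \<open>Coordinate changes and meromorphic functions on a fixed surface\<close>

locale surface =
  fixes X :: "'a surface"
  assumes riemann_surface: "riemann_surface X"
begin

abbreviation "T \<equiv> surf_top X"

lemma atlas_compatible: "(U, z) \<in> surf_atlas X \<Longrightarrow> compatible_chart X U z"
  using riemann_surface by (auto simp: riemann_surface_def compatible_chart_def)

lemma atlas_cover:
  assumes "x \<in> topspace T"
  obtains U z where "(U, z) \<in> surf_atlas X" "x \<in> U"
  using assms riemann_surface unfolding riemann_surface_def by blast

lemma compatible_chart_subset:
  assumes "compatible_chart X U z" "openin T W" "W \<subseteq> U"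
  shows "compatible_chart X W z"
  unfolding compatible_chart_def
proof safe
  note c = compatible_chart_complex_chart[OF assms(1)]
  show "complex_chart T W z"
    using c assms(2,3) by (rule complex_chart_subset)
  fix U' z' assume U': "(U', z') \<in> surf_atlas X"
  then have "inj_on z' U'"
    using atlas_compatible compatible_chart_complex_chart complex_chart_inj by blast
  moreover have "holo_change U z U' z'" "holo_change U' z' U z"
    using assms(1) U' by (auto simp: compatible_chart_def)
  ultimately show "holo_change W z U' z'" "holo_change U' z' W z"
    using complex_chart_inj[OF c] assms(3) by (auto intro: holo_change_subset)
qed

lemma topspace_atin_neq_bot: "x \<in> topspace T \<Longrightarrow> atin T x \<noteq> bot"
  by (metis atlas_cover atlas_compatible compatible_chart_complex_chart atin_chart_neq_bot)

lemma t1_space_surface: "t1_space T"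
  using riemann_surface by (simp add: riemann_surface_def Hausdorff_imp_t1_space)

lemma atlas_change_analytic:
  assumes "compatible_chart X U z" "(U0, z0) \<in> surf_atlas X" "x \<in> U" "x \<in> U0"
  shows "(z0 \<circ> inv_into U z) analytic_on {z x}" "(z \<circ> inv_into U0 z0) analytic_on {z0 x}"
proof -
  have c: "complex_chart T U z" "complex_chart T U0 z0"
    using assms atlas_compatible compatible_chart_complex_chart by blast+
  then have "openin T (U \<inter> U0)"
    by (auto simp: complex_chart_def)
  then have "open (z ` (U \<inter> U0))" "open (z0 ` (U0 \<inter> U))"
    using c complex_chart_open_image by (metis inf_le1 inf_commute)+
  moreover have "(z0 \<circ> inv_into U z) holomorphic_on z ` (U \<inter> U0)"
    "(z \<circ> inv_into U0 z0) holomorphic_on z0 ` (U0 \<inter> U)"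
    using assms(1,2) by (auto simp: compatible_chart_def holo_change_def)
  ultimately show "(z0 \<circ> inv_into U z) analytic_on {z x}" "(z \<circ> inv_into U0 z0) analytic_on {z0 x}"
    unfolding analytic_at using assms(3,4) by blast+
qed

lemma eventually_inv_into_atlas:
  assumes "compatible_chart X U z" "(U0, z0) \<in> surf_atlas X" "x \<in> U" "x \<in> U0"
  shows "\<forall>\<^sub>F t in nhds (z x). inv_into U0 z0 ((z0 \<circ> inv_into U z) t) = inv_into U z t"
proof -
  have c: "complex_chart T U z" "complex_chart T U0 z0"
    using assms atlas_compatible compatible_chart_complex_chart by blast+
  then have "openin T U0"
    by (simp add: complex_chart_def)
  from eventually_inv_into_chart[OF c(1) this assms(3,4)] show ?thesis
    by eventually_elim (use complex_chart_inj[OF c(2)] in auto)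
qed

text \<open>\<open>holo_on\<close> is tested in atlas charts only; any other compatible chart is
  reached by composing with the analytic change to an atlas chart around \<open>x\<close>.\<close>

lemma holo_on_analytic:
  assumes "compatible_chart X U z" "openin T S" "holo_on X S f" "x \<in> U" "x \<in> S"
  shows "(\<lambda>t. f (inv_into U z t)) analytic_on {z x}"
proof -
  obtain U0 z0 where U0: "(U0, z0) \<in> surf_atlas X" "x \<in> U0"
    using assms(2,5) atlas_cover openin_subset by (metis subsetD)
  note c0 = compatible_chart_complex_chart[OF atlas_compatible[OF U0(1)]]
  have zx: "inv_into U z (z x) = x"
    using assms complex_chart_inj compatible_chart_complex_chart by (metis inv_into_f_f)
  have "open (z0 ` (U0 \<inter> S))"
    using c0 complex_chart_open_image[OF c0, of "U0 \<inter> S"] assms(2) by (auto simp: complex_chart_def)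
  then have "(f \<circ> inv_into U0 z0) analytic_on {z0 x}"
    unfolding analytic_at using assms(3,5) U0 by (fastforce simp: holo_on_def)
  then have "(f \<circ> inv_into U0 z0 \<circ> (z0 \<circ> inv_into U z)) analytic_on {z x}"
    using atlas_change_analytic[OF assms(1) U0(1) assms(4) U0(2)] zx
    by (intro analytic_on_compose) auto
  moreover have "\<forall>\<^sub>F t in nhds (z x). (f \<circ> inv_into U0 z0 \<circ> (z0 \<circ> inv_into U z)) t = f (inv_into U z t)"
    using eventually_inv_into_atlas[OF assms(1) U0(1) assms(4) U0(2)]
    by eventually_elim (simp add: o_def)
  ultimately show ?thesis
    by (simp add: analytic_at_cong)
qed

text \<open>Neither chart need belong to the atlas. Compatibility of \<open>z'\<close> with the
  atlas says that \<open>z'\<close> is a holomorphic function on \<open>U'\<close>, which can then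
  be read in the coordinate \<open>z\<close>.\<close>

lemma compatible_change_analytic:
  assumes "compatible_chart X U z" "compatible_chart X U' z'" "x \<in> U" "x \<in> U'"
  shows "(\<lambda>t. z' (inv_into U z t)) analytic_on {z x}"
proof (rule holo_on_analytic[OF assms(1) _ _ assms(3,4)])
  show "openin T U'"
    using assms(2) by (simp add: compatible_chart_def complex_chart_def)
  show "holo_on X U' z'"
    using assms(2) by (auto simp: holo_on_def compatible_chart_def holo_change_def)
qed

text \<open>A coordinate change is injective, and an injective holomorphic function has no critical
  points. The powers of this derivative appear on the diagonal of \<open>L\<close>.\<close>

lemma compatible_change_deriv_nonzero:
  assumes "compatible_chart X U z" "compatible_chart X U' z'" "x \<in> U" "x \<in> U'"
  shows "deriv (\<lambda>t. z' (inv_into U z t)) (z x) \<noteq> 0"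
proof -
  note c = compatible_chart_complex_chart[OF assms(1)] compatible_chart_complex_chart[OF assms(2)]
  obtain S where S: "open S" "z x \<in> S" "(\<lambda>t. z' (inv_into U z t)) holomorphic_on S"
    using compatible_change_analytic[OF assms] analytic_at by metis
  have "openin T (U \<inter> U')"
    using c by (auto simp: complex_chart_def)
  then have "open (z ` (U \<inter> U'))"
    using complex_chart_open_image[OF c(1)] by (metis inf_le1)
  moreover have "inj_on (\<lambda>t. z' (inv_into U z t)) (S \<inter> z ` (U \<inter> U'))"
  proof (rule inj_onI)
    fix s t assume st: "s \<in> S \<inter> z ` (U \<inter> U')" "t \<in> S \<inter> z ` (U \<inter> U')"
      "z' (inv_into U z s) = z' (inv_into U z t)"
    then obtain v w where "s = z v" "v \<in> U" "v \<in> U'" "t = z w" "w \<in> U" "w \<in> U'"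
      by blast
    with st(3) show "s = t"
      using complex_chart_inj[OF c(1)] complex_chart_inj[OF c(2)] by (simp add: inj_on_eq_iff)
  qed
  moreover have "(\<lambda>t. z' (inv_into U z t)) holomorphic_on S \<inter> z ` (U \<inter> U')"
    using S(3) by (rule holomorphic_on_subset) auto
  ultimately show ?thesis
    using S assms(3,4) by (intro holomorphic_injective_imp_regular[of _ "S \<inter> z ` (U \<inter> U')"]) auto
qed

lemma meromorphic_fun_chart:
  assumes "compatible_chart X U z" "meromorphic_fun X f"
  shows "(\<lambda>t. f (inv_into U z t)) meromorphic_on z ` U"
proof (subst meromorphic_on_meromorphic_at, safe)
  fix x assume x: "x \<in> U"
  obtain U0 z0 where U0: "(U0, z0) \<in> surf_atlas X" "x \<in> U0"
    using x complex_chart_subset_topspace[OF compatible_chart_complex_chart[OF assms(1)]]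
    by (metis atlas_cover subsetD)
  have zx: "inv_into U z (z x) = x"
    using assms x complex_chart_inj compatible_chart_complex_chart by (metis inv_into_f_f)
  have "(f \<circ> inv_into U0 z0) meromorphic_on z0 ` U0"
    using assms(2) U0(1) by (auto simp: meromorphic_fun_def)
  then have "(f \<circ> inv_into U0 z0) meromorphic_on {z0 x}"
    by (rule meromorphic_on_subset) (use U0 in auto)
  then have "(\<lambda>t. (f \<circ> inv_into U0 z0) ((z0 \<circ> inv_into U z) t)) meromorphic_on {z x}"
    by (rule meromorphic_on_compose[OF _ atlas_change_analytic(1)[OF assms(1) U0(1) x U0(2)]])
      (simp add: zx)
  moreover have "\<forall>\<^sub>F t in nhds (z x). (f \<circ> inv_into U0 z0) ((z0 \<circ> inv_into U z) t) = f (inv_into U z t)"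
    using eventually_inv_into_atlas[OF assms(1) U0(1) x U0(2)]
    by eventually_elim (simp add: o_def)
  then have "\<forall>\<^sub>F t in at (z x). (f \<circ> inv_into U0 z0) ((z0 \<circ> inv_into U z) t) = f (inv_into U z t)"
    by (rule eventually_nhds_at)
  ultimately show "(\<lambda>t. f (inv_into U z t)) meromorphic_on {z x}"
    by (subst meromorphic_on_cong[OF _ refl, symmetric]) auto
qed

text \<open>Being zero near a point and being nonzero off it are the only local alternatives; as the
  first fails somewhere, connectedness excludes it everywhere. Scaling by \<open>f\<close> is thus
  invertible off a discrete set.\<close>

lemma meromorphic_fun_eventually_nonzero:
  assumes f: "meromorphic_fun X f" "nonzero_fun X f" and x: "x \<in> topspace T"
  shows "\<forall>\<^sub>F y in atin T x. f y \<noteq> 0"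
proof -
  have "(\<forall>\<^sub>F y in atin T x. f y \<noteq> 0) \<or> (\<forall>\<^sub>F y in atin T x. \<not> f y \<noteq> 0)" if x: "x \<in> topspace T" for x
  proof -
    obtain U z where U: "(U, z) \<in> surf_atlas X" "x \<in> U"
      using atlas_cover[OF x] by metis
    note c = atlas_compatible[OF U(1)]
    have "(\<lambda>t. f (inv_into U z t)) meromorphic_on {z x}"
      using meromorphic_fun_chart[OF c f(1)] by (rule meromorphic_on_subset) (use U in auto)
    from meromorphic_eventually_zero_or_nonzero[OF this] show ?thesis
      using eventually_chart[OF compatible_chart_complex_chart[OF c] U(2)] by auto
  qed
  moreover obtain x0 where "x0 \<in> topspace T" "\<not> (\<forall>\<^sub>F y in atin T x0. \<not> f y \<noteq> 0)"
    using f(2) by (auto simp: nonzero_fun_def mero_ae_def)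
  moreover have "connected_space T"
    using riemann_surface by (simp add: riemann_surface_def)
  ultimately show ?thesis
    using connected_space_eventually_dichotomy[of T "\<lambda>y. f y \<noteq> 0"] t1_space_surface
      topspace_atin_neq_bot x by blast
qed

end


section \<open>Trivializations\<close>

lemma linear_triv_subset: "linear_triv V U \<phi> \<Longrightarrow> W \<subseteq> U \<Longrightarrow> linear_triv V W \<phi>"
  unfolding linear_triv_def by blast

lemma holo_transition_subset:
  fixes V :: "('a, 'v, 'n::finite) vbundle"
  assumes "holo_transition X V U \<phi> U' \<phi>'" "W \<subseteq> U"
  shows "holo_transition X V W \<phi> U' \<phi>'"
proof -
  obtain g :: "'a \<Rightarrow> complex ^ 'n ^ 'n" where g: "\<forall>i j. holo_on X (U \<inter> U') (\<lambda>x. g x $ i $ j)"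
    "\<forall>x\<in>U \<inter> U'. invertible (g x) \<and> (\<forall>e\<in>fibre V x. \<phi> e = \<phi>' e v* g x)"
    using assms(1) unfolding holo_transition_def by blast
  then have "\<forall>i j. holo_on X (W \<inter> U') (\<lambda>x. g x $ i $ j)"
    using assms(2) by (meson Int_mono holo_on_subset order_refl)
  with g(2) assms(2) show ?thesis
    unfolding holo_transition_def by blast
qed

lemma holo_triv_subset:
  assumes "holo_triv X V U \<phi>" "openin (surf_top X) W" "W \<subseteq> U"
  shows "holo_triv X V W \<phi>"
  using assms linear_triv_subset[of V U \<phi> W] holo_transition_subset[of X V U \<phi> _ _ W]
  by (auto simp: holo_triv_def)

definition pf_related ::
  "'a surface \<Rightarrow> ('a, 'v, 'n::finite) vbundle \<Rightarrow> 'a set \<Rightarrow> ('v \<Rightarrow> complex ^ 'n)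
     \<Rightarrow> 'a set \<Rightarrow> ('v \<Rightarrow> complex ^ 'n) \<Rightarrow> bool" where
  "pf_related X V U \<phi> U' \<phi>' \<longleftrightarrow>
     (\<exists>(l :: 'a \<Rightarrow> complex) (M :: 'a \<Rightarrow> complex ^ 'n ^ 'n).
        holo_on X (U \<inter> U') l \<and> (\<forall>x\<in>U \<inter> U'. l x \<noteq> 0) \<and> (\<forall>x\<in>U \<inter> U'. invertible (M x)) \<and>
        (\<forall>x\<in>U \<inter> U'. \<exists>N. openin (surf_top X) N \<and> x \<in> N \<and> M constant_on (N \<inter> (U \<inter> U'))) \<and>
        (\<forall>x\<in>U \<inter> U'. \<forall>e\<in>fibre V x. \<phi> e = l x *s (\<phi>' e v* M x)))"

lemma pf_triv_iff:
  "pf_triv X V P U \<phi> \<longleftrightarrow> holo_triv X V U \<phi> \<and> (\<forall>(U', \<phi>')\<in>P. pf_related X V U \<phi> U' \<phi>')"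
  unfolding pf_triv_def pf_related_def by (rule refl)

lemma pf_related_subset:
  assumes "pf_related X V U \<phi> U' \<phi>'" "W \<subseteq> U"
  shows "pf_related X V W \<phi> U' \<phi>'"
proof -
  obtain l M where *:
    "holo_on X (U \<inter> U') l" "\<forall>x\<in>U \<inter> U'. l x \<noteq> 0" "\<forall>x\<in>U \<inter> U'. invertible (M x)"
    "\<forall>x\<in>U \<inter> U'. \<exists>N. openin (surf_top X) N \<and> x \<in> N \<and> M constant_on (N \<inter> (U \<inter> U'))"
    "\<forall>x\<in>U \<inter> U'. \<forall>e\<in>fibre V x. \<phi> e = l x *s (\<phi>' e v* M x)"
    using assms(1) unfolding pf_related_def by blast
  show ?thesis
    unfolding pf_related_def
  proof (intro exI conjI)
    show "holo_on X (W \<inter> U') l"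
      by (rule holo_on_subset[OF *(1)]) (use assms(2) in auto)
    show "\<forall>x\<in>W \<inter> U'. \<exists>N. openin (surf_top X) N \<and> x \<in> N \<and> M constant_on (N \<inter> (W \<inter> U'))"
    proof
      fix x assume "x \<in> W \<inter> U'"
      then obtain N where N: "openin (surf_top X) N" "x \<in> N" "M constant_on (N \<inter> (U \<inter> U'))"
        using *(4) assms(2) by blast
      have "M constant_on (N \<inter> (W \<inter> U'))"
        by (rule constant_on_subset[OF N(3)]) (use assms(2) in auto)
      with N show "\<exists>N. openin (surf_top X) N \<and> x \<in> N \<and> M constant_on (N \<inter> (W \<inter> U'))"
        by blast
    qed
  qed (use * assms(2) in auto)
qed

lemma pf_triv_subset:
  assumes "pf_triv X V P U \<phi>" "openin (surf_top X) W" "W \<subseteq> U"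
  shows "pf_triv X V P W \<phi>"
  using assms holo_triv_subset[of X V U \<phi> W] pf_related_subset[of X V U \<phi> _ _ W]
  by (auto simp: pf_triv_iff)

lemma linear_triv_inj:
  "linear_triv V U \<phi> \<Longrightarrow> x \<in> U \<Longrightarrow> e \<in> fibre V x \<Longrightarrow> e' \<in> fibre V x \<Longrightarrow> \<phi> e = \<phi> e' \<Longrightarrow> e = e'"
  unfolding linear_triv_def bij_betw_def inj_on_def by blast

lemma linear_triv_inv:
  assumes "linear_triv V U \<phi>" "x \<in> U"
  shows "inv_into (fibre V x) \<phi> v \<in> fibre V x" "\<phi> (inv_into (fibre V x) \<phi> v) = v"
proof -
  have "v \<in> \<phi> ` fibre V x"
    using assms unfolding linear_triv_def bij_betw_def by blast
  then show "inv_into (fibre V x) \<phi> v \<in> fibre V x" "\<phi> (inv_into (fibre V x) \<phi> v) = v"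
    by (auto intro: inv_into_into f_inv_into_f)
qed

lemma linear_triv_smul:
  assumes "linear_triv V U \<phi>" "x \<in> U" "e \<in> fibre V x"
  shows "smul V c e \<in> fibre V x" "\<phi> (smul V c e) = c *s \<phi> e"
  using assms unfolding linear_triv_def by blast+

lemma linear_triv_vadd:
  assumes "linear_triv V U \<phi>" "x \<in> U" "e \<in> fibre V x" "e' \<in> fibre V x"
  shows "vadd V e e' \<in> fibre V x" "\<phi> (vadd V e e') = \<phi> e + \<phi> e'"
  using assms unfolding linear_triv_def by blast+

lemma fibre_endo_linear_triv:
  assumes "linear_triv V U \<phi>" "x \<in> U"
  shows "fibre_endo V x (\<lambda>e. inv_into (fibre V x) \<phi> (\<phi> e v* M))"
  unfolding fibre_endo_def
proof (intro conjI ballI allI)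
  let ?q = "\<lambda>e. inv_into (fibre V x) \<phi> (\<phi> e v* M)"
  note q = linear_triv_inv[OF assms] and s = linear_triv_smul[OF assms] and a = linear_triv_vadd[OF assms]
  show "?q e \<in> fibre V x" for e
    by (rule q)
  show "?q (vadd V e e') = vadd V (?q e) (?q e')" if "e \<in> fibre V x" "e' \<in> fibre V x" for e e'
    by (rule linear_triv_inj[OF assms]) (use that in \<open>auto simp: q a vector_matrix_left_distrib\<close>)
  show "?q (smul V c e) = smul V c (?q e)" if "e \<in> fibre V x" for c e
    by (rule linear_triv_inj[OF assms]) (use that in \<open>auto simp: q s scalar_vector_matrix_assoc\<close>)
qed

text \<open>Transporting \<open>q\<close> to the model fibre gives a linear map of vectors. Its
  library matrix acts on columns, so the transpose is the matrix acting on row vectors.\<close>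

lemma fibre_endo_has_matrix:
  assumes "linear_triv V U \<phi>" "x \<in> U" "fibre_endo V x q"
  shows "\<exists>M. matrix_of_endo V \<phi> x q M"
proof -
  define e where "e = (\<lambda>v. inv_into (fibre V x) \<phi> v)"
  have e: "e v \<in> fibre V x" "\<phi> (e v) = v" for v
    using linear_triv_inv[OF assms(1,2)] by (auto simp: e_def)
  have q: "q (e v) \<in> fibre V x" for v
    using assms(3) e unfolding fibre_endo_def by blast
  define f where "f = (\<lambda>v. \<phi> (q (e v)))"
  have add: "f (v + w) = f v + f w" for v w
  proof -
    have "e (v + w) = vadd V (e v) (e w)"
      by (rule linear_triv_inj[OF assms(1,2)]) (auto simp: e linear_triv_vadd[OF assms(1,2)])
    moreover have "q (vadd V (e v) (e w)) = vadd V (q (e v)) (q (e w))"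
      using assms(3) e unfolding fibre_endo_def by blast
    ultimately show ?thesis
      by (simp add: f_def linear_triv_vadd[OF assms(1,2)] q)
  qed
  have scale: "f (c *s v) = c *s f v" for c v
  proof -
    have "e (c *s v) = smul V c (e v)"
      by (rule linear_triv_inj[OF assms(1,2)]) (auto simp: e linear_triv_smul[OF assms(1,2)])
    moreover have "q (smul V c (e v)) = smul V c (q (e v))"
      using assms(3) e unfolding fibre_endo_def by blast
    ultimately show ?thesis
      by (simp add: f_def linear_triv_smul[OF assms(1,2)] q)
  qed
  have "Vector_Spaces.linear (*s) (*s) f"
    by (simp add: Vector_Spaces.linear_iff add scale vec.vector_space_axioms)
  then have "matrix f *v v = f v" for v
    by (rule matrix_works)
  then have f: "f v = v v* transpose (matrix f)" for v
    by simp
  have "\<phi> (q d) = \<phi> d v* transpose (matrix f)" if "d \<in> fibre V x" for d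
  proof -
    have "e (\<phi> d) = d"
      by (rule linear_triv_inj[OF assms(1,2)]) (auto simp: e that)
    then show ?thesis
      using f[of "\<phi> d"] by (simp add: f_def)
  qed
  then show ?thesis
    unfolding matrix_of_endo_def by blast
qed

lemma matrix_of_endo_unique:
  assumes "linear_triv V U \<phi>" "x \<in> U" "matrix_of_endo V \<phi> x q M" "matrix_of_endo V \<phi> x q N"
  shows "M = N"
proof (rule matrix_eq_if_vector_matrix_eq)
  fix v
  show "v v* M = v v* N"
    using assms(3,4) linear_triv_inv[OF assms(1,2), of v] unfolding matrix_of_endo_def by metis
qed

lemma matrix_of_endo_local_quotient:
  assumes "linear_triv V U \<phi>" "x \<in> U"
  shows "matrix_of_endo V \<phi> x (local_wronskian_quotient V U z \<phi> A B x)
    (wronskian_quotient_matrix U z \<phi> A B (z x))"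
  unfolding matrix_of_endo_def local_wronskian_quotient_def by (simp add: linear_triv_inv[OF assms])

lemma matrix_of_endo_cong:
  assumes "\<forall>e\<in>fibre V x. q e = q' e" "matrix_of_endo V \<phi> x q M"
  shows "matrix_of_endo V \<phi> x q' M"
  using assms by (simp add: matrix_of_endo_def)

section \<open>Projectively flat charts and their transitions in a fixed bundle\<close>

locale pf_bundle = surface X
  for X :: "'a surface" +
  fixes V :: "('a, 'v, 'n::{finite, linorder}) vbundle"
    and P :: "('a set \<times> ('v \<Rightarrow> complex ^ ('n::{finite, linorder}))) set"
  assumes vector_bundle: "holomorphic_vector_bundle X V"
    and pf_structure: "projectively_flat_structure X V P"
begin

text \<open>Two members of the structure are related by a single matrix on their overlap, so local
  constancy holds with the whole surface as neighbourhood.\<close>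

lemma pf_triv_structure:
  assumes "(U, \<phi>) \<in> P"
  shows "pf_triv X V P U \<phi>"
proof -
  have *: "holo_triv X V U \<phi>"
    using pf_structure assms by (auto simp: projectively_flat_structure_def)
  then have U: "U \<subseteq> topspace T"
    by (auto simp: holo_triv_def dest: openin_subset)
  have "pf_related X V U \<phi> U' \<phi>'" if U': "(U', \<phi>') \<in> P" for U' \<phi>'
  proof -
    obtain l and M :: "complex ^ ('n::{finite, linorder}) ^ ('n::{finite, linorder})" where
      "holo_on X (U \<inter> U') l" "\<forall>x\<in>U \<inter> U'. l x \<noteq> 0" "invertible M"
      "\<forall>x\<in>U \<inter> U'. \<forall>e\<in>fibre V x. \<phi> e = l x *s (\<phi>' e v* M)"
      using pf_structure assms U' unfolding projectively_flat_structure_def by fast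
    moreover have "\<forall>x\<in>U \<inter> U'. \<exists>N. openin T N \<and> x \<in> N \<and> (\<lambda>_. M) constant_on (N \<inter> (U \<inter> U'))"
      using U by (auto simp: constant_on_def intro!: exI[of _ "topspace T"])
    ultimately show ?thesis
      unfolding pf_related_def by (intro exI[of _ l] exI[of _ "\<lambda>_. M"]) simp
  qed
  with * show ?thesis
    by (auto simp: pf_triv_iff)
qed

lemma pf_trivD:
  assumes "pf_triv X V P U \<phi>"
  shows "holo_triv X V U \<phi>" "openin T U" "linear_triv V U \<phi>"
  using assms by (auto simp: pf_triv_def holo_triv_def)

lemma coord_chartD:
  assumes "coord_chart X U z"
  shows "compatible_chart X U z" "complex_chart T U z" "openin T U" "inj_on z U" "U \<subseteq> topspace T"
proof -
  show *: "compatible_chart X U z" "complex_chart T U z"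
    using assms by (auto simp: coord_chart_iff compatible_chart_def)
  show "openin T U" "inj_on z U" "U \<subseteq> topspace T"
    using complex_chart_inj[OF *(2)] complex_chart_subset_topspace[OF *(2)] *(2)
    by (auto simp: complex_chart_def)
qed

text \<open>\<open>W\<close> is the preimage of a disc, which secures the connectedness demanded by
  \<open>coord_chart\<close>. The coordinate \<open>z\<close> itself is kept, so objects over
  \<open>W\<close> and over \<open>U\<close> remain functions of the same variable.\<close>

lemma pf_chart_exists_within:
  assumes "compatible_chart X U z" "x \<in> U"
  obtains W \<phi> where "x \<in> W" "W \<subseteq> U" "coord_chart X W z" "pf_triv X V P W \<phi>"
proof -
  note c = compatible_chart_complex_chart[OF assms(1)]
  have "x \<in> topspace T"
    using complex_chart_subset_topspace[OF c] assms(2) by blast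
  then obtain U' \<phi> where U': "(U', \<phi>) \<in> P" "x \<in> U'"
    using pf_structure unfolding projectively_flat_structure_def by blast
  note \<phi> = pf_triv_structure[OF U'(1)]
  have "openin T (U \<inter> U')"
    using c pf_trivD(2)[OF \<phi>] by (auto simp: complex_chart_def)
  then have "open (z ` (U \<inter> U'))"
    using complex_chart_open_image[OF c] by (metis inf_le1)
  moreover have "z x \<in> z ` (U \<inter> U')"
    using assms(2) U'(2) by blast
  ultimately obtain r where r: "r > 0" "ball (z x) r \<subseteq> z ` (U \<inter> U')"
    using open_contains_ball by blast
  define W where "W = {y \<in> U \<inter> U'. z y \<in> ball (z x) r}"
  have W: "W \<subseteq> U" "W \<subseteq> U'" "x \<in> W" "z ` W = ball (z x) r"
    using r assms(2) U'(2) by (auto simp: W_def)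
  have "openin T W" "connectedin T W"
    using complex_chart_open_image[OF c W(1)] complex_chart_connected_image[OF c W(1)] W(4)
    by auto
  then have "coord_chart X W z" "pf_triv X V P W \<phi>"
    using compatible_chart_subset[OF assms(1)] pf_triv_subset[OF \<phi>] W
    by (auto simp: coord_chart_iff)
  with W that show ?thesis
    by blast
qed

lemma pf_chart_exists:
  assumes "x \<in> topspace T"
  obtains W z \<phi> where "x \<in> W" "coord_chart X W z" "pf_triv X V P W \<phi>"
proof -
  obtain U z where "(U, z) \<in> surf_atlas X" "x \<in> U"
    using assms by (rule atlas_cover)
  then show ?thesis
    using that by (metis atlas_compatible pf_chart_exists_within)
qed

text \<open>\<open>pf_triv\<close> relates a trivialization only to members of \<open>P\<close>, so
  two of them are compared through a member around \<open>x\<close>: \<phi> = l1 \<phi>0 M1 and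
  \<phi>' = l2 \<phi>0 M2 give the scalar l2 / l1 and the matrix M1^-1 M2. Shrinking to
  \<open>N\<close> makes the locally constant factors constant.\<close>

lemma pf_transition:
  assumes pf: "pf_triv X V P U \<phi>" "pf_triv X V P U' \<phi>'" and x: "x \<in> U" "x \<in> U'"
  obtains N l and M :: "complex ^ ('n::{finite, linorder}) ^ ('n::{finite, linorder})"
  where "openin T N" "x \<in> N" "N \<subseteq> U \<inter> U'" "holo_on X N l" "\<forall>y\<in>N. l y \<noteq> 0" "invertible M"
    "\<forall>y\<in>N. \<forall>e\<in>fibre V y. \<phi>' e = l y *s (\<phi> e v* M)"
proof -
  have "x \<in> topspace T"
    using pf_trivD(2)[OF pf(1)] x(1) openin_subset by blast
  then obtain U0 \<phi>0 where U0: "(U0, \<phi>0) \<in> P" "x \<in> U0"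
    using pf_structure unfolding projectively_flat_structure_def by blast
  have *: "\<exists>N l. \<exists>M :: complex ^ ('n::{finite, linorder}) ^ ('n::{finite, linorder}).
      openin T N \<and> x \<in> N \<and> N \<subseteq> U \<inter> U0 \<and> holo_on X N l \<and> (\<forall>y\<in>N. l y \<noteq> 0) \<and> invertible M \<and>
      (\<forall>y\<in>N. \<forall>e\<in>fibre V y. \<phi> e = l y *s (\<phi>0 e v* M))"
    if \<phi>: "pf_triv X V P U \<phi>" and xU: "x \<in> U" for U \<phi>
  proof -
    have "pf_related X V U \<phi> U0 \<phi>0"
      using \<phi> U0(1) unfolding pf_triv_iff by blast
    then obtain l M where lM:
      "holo_on X (U \<inter> U0) l" "\<forall>x\<in>U \<inter> U0. l x \<noteq> 0" "\<forall>x\<in>U \<inter> U0. invertible (M x)"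
      "\<forall>x\<in>U \<inter> U0. \<exists>N. openin T N \<and> x \<in> N \<and> M constant_on (N \<inter> (U \<inter> U0))"
      "\<forall>x\<in>U \<inter> U0. \<forall>e\<in>fibre V x. \<phi> e = l x *s (\<phi>0 e v* M x)"
      unfolding pf_related_def by blast
    obtain N where N: "openin T N" "x \<in> N" "M constant_on (N \<inter> (U \<inter> U0))"
      using lM(4) xU U0(2) by blast
    have M: "M y = M x" if "y \<in> N \<inter> (U \<inter> U0)" for y
      using N(2,3) that xU U0(2) unfolding constant_on_def by (metis IntI)
    have "openin T (N \<inter> (U \<inter> U0))"
      using N(1) pf_trivD(2)[OF \<phi>] pf_trivD(2)[OF pf_triv_structure[OF U0(1)]] by blast
    moreover have "holo_on X (N \<inter> (U \<inter> U0)) l"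
      using lM(1) by (rule holo_on_subset) blast
    moreover have "\<forall>y\<in>N \<inter> (U \<inter> U0). \<forall>e\<in>fibre V y. \<phi> e = l y *s (\<phi>0 e v* M x)"
      using lM(5) M by auto
    ultimately show ?thesis
      using lM(2,3) N(2) xU U0(2)
      by (intro exI[of _ "N \<inter> (U \<inter> U0)"] exI[of _ l] exI[of _ "M x"]) auto
  qed
  obtain N1 l1 and M1 :: "complex ^ ('n::{finite, linorder}) ^ ('n::{finite, linorder})" where 1:
    "openin T N1" "x \<in> N1" "N1 \<subseteq> U \<inter> U0" "holo_on X N1 l1" "\<forall>y\<in>N1. l1 y \<noteq> 0" "invertible M1"
    "\<forall>y\<in>N1. \<forall>e\<in>fibre V y. \<phi> e = l1 y *s (\<phi>0 e v* M1)"
    using *[OF pf(1) x(1)] by metis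
  obtain N2 l2 and M2 :: "complex ^ ('n::{finite, linorder}) ^ ('n::{finite, linorder})" where 2:
    "openin T N2" "x \<in> N2" "N2 \<subseteq> U' \<inter> U0" "holo_on X N2 l2" "\<forall>y\<in>N2. l2 y \<noteq> 0" "invertible M2"
    "\<forall>y\<in>N2. \<forall>e\<in>fibre V y. \<phi>' e = l2 y *s (\<phi>0 e v* M2)"
    using *[OF pf(2) x(2)] by metis
  have "holo_on X (N1 \<inter> N2) (\<lambda>y. l2 y / l1 y)"
    unfolding holo_on_def
  proof safe
    fix A z assume Az: "(A, z) \<in> surf_atlas X"
    have "inj_on z A"
      using Az atlas_compatible compatible_chart_complex_chart complex_chart_inj by blast
    then have "l1 (inv_into A z t) \<noteq> 0" if "t \<in> z ` (A \<inter> (N1 \<inter> N2))" for t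
      using that 1(5) by auto
    moreover have "(l1 \<circ> inv_into A z) holomorphic_on z ` (A \<inter> (N1 \<inter> N2))"
      "(l2 \<circ> inv_into A z) holomorphic_on z ` (A \<inter> (N1 \<inter> N2))"
      using holo_on_subset[OF 1(4), of "N1 \<inter> N2"] holo_on_subset[OF 2(4), of "N1 \<inter> N2"] Az
      by (auto simp: holo_on_def)
    ultimately show "((\<lambda>y. l2 y / l1 y) \<circ> inv_into A z) holomorphic_on z ` (A \<inter> (N1 \<inter> N2))"
      unfolding o_def by (intro holomorphic_intros)
  qed
  moreover have "\<phi>' e = (l2 y / l1 y) *s (\<phi> e v* (matrix_inv M1 ** M2))"
    if "y \<in> N1 \<inter> N2" "e \<in> fibre V y" for y e
  proof -
    have e: "\<phi> e = l1 y *s (\<phi>0 e v* M1)" "\<phi>' e = l2 y *s (\<phi>0 e v* M2)" "l1 y \<noteq> 0"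
      using 1(5,7) 2(7) that by auto
    have "\<phi> e v* (matrix_inv M1 ** M2) = l1 y *s (\<phi>0 e v* ((M1 ** matrix_inv M1) ** M2))"
      by (simp add: e(1) vector_matrix_mul_assoc scalar_vector_matrix_assoc matrix_mul_assoc)
    also have "\<dots> = l1 y *s (\<phi>0 e v* M2)"
      by (simp add: matrix_inv_right[OF 1(6)])
    finally show ?thesis
      by (simp add: e vector_smult_assoc)
  qed
  moreover have "invertible (matrix_inv M1 ** M2)"
    using 1(6) 2(6) by (intro invertible_mult invertible_matrix_inv)
  ultimately show ?thesis
    using 1 2 by (intro that[of "N1 \<inter> N2" "\<lambda>y. l2 y / l1 y" "matrix_inv M1 ** M2"]) auto
qed

end


section \<open>Wronskian matrices under a change of chart\<close>

lemma wronskian_matrix_eq_wronski: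
  "wronskian_matrix U z \<phi> A = wronski (\<lambda>s. \<phi> (A (inv_into U z s)))"
  by (simp add: wronskian_matrix_def wronski_def fun_eq_iff)

lemma eventually_atin_openin: "openin T W \<Longrightarrow> x \<in> W \<Longrightarrow> \<forall>\<^sub>F y in atin T x. y \<in> W"
  unfolding eventually_atin by blast

text \<open>The transformation law differentiates the components repeatedly at the point, which is
  legitimate only where they are analytic; at a pole the values of \<open>deriv\<close> carry no
  meaning.\<close>

definition analytic_in ::
  "'a set \<Rightarrow> ('a \<Rightarrow> complex) \<Rightarrow> ('v \<Rightarrow> complex ^ 'n) \<Rightarrow> ('a \<Rightarrow> 'v) \<Rightarrow> 'a \<Rightarrow> bool" where
  "analytic_in U z \<phi> A x \<longleftrightarrow> (\<forall>j. (\<lambda>t. \<phi> (A (inv_into U z t)) $ j) analytic_on {z x})"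

context pf_bundle
begin

text \<open>The pointwise part of \<open>meromorphic_section\<close>. The transformation law needs
  values in the fibres and analyticity at one point, not meromorphy everywhere.\<close>

definition is_section :: "('a \<Rightarrow> 'v) \<Rightarrow> bool" where
  "is_section A \<longleftrightarrow> (\<forall>x\<in>topspace T. A x \<in> fibre V x)"

text \<open>The chart data alone determine \<open>L\<close>, \<open>M\<close> and \<open>c\<close>;
  the section is quantified last, so numerator and denominator of a quotient can be transformed with
  the same matrices.\<close>

lemma wronskian_matrix_change:
  assumes "coord_chart X U z" "pf_triv X V P U \<phi>" "coord_chart X U' z'" "pf_triv X V P U' \<phi>'"
    and x: "x \<in> U" "x \<in> U'"
  obtains c and L M :: "complex ^ ('n::{finite, linorder}) ^ ('n::{finite, linorder})"
  where "invertible L" "invertible M" "c \<noteq> 0" "\<And>e. e \<in> fibre V x \<Longrightarrow> \<phi>' e = c *s (\<phi> e v* M)"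
    "\<And>A. is_section A \<Longrightarrow> analytic_in U z \<phi> A x \<Longrightarrow> analytic_in U' z' \<phi>' A x \<and>
      wronskian_matrix U' z' \<phi>' A (z' x) = L ** wronskian_matrix U z \<phi> A (z x) ** M"
proof -
  note c = coord_chartD[OF assms(1)] and c' = coord_chartD[OF assms(3)]
  obtain N l and M :: "complex ^ ('n::{finite, linorder}) ^ ('n::{finite, linorder})"
    where N: "openin T N" "x \<in> N" "N \<subseteq> U \<inter> U'" "holo_on X N l" "\<forall>y\<in>N. l y \<noteq> 0" "invertible M"
      "\<forall>y\<in>N. \<forall>e\<in>fibre V y. \<phi>' e = l y *s (\<phi> e v* M)"
    using pf_transition[OF assms(2,4) x] by metis
  \<comment> \<open>The coordinate change runs from \<open>z'\<close> to \<open>z\<close>, and the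
    scalar is read in \<open>z'\<close>: components in the primed chart are expressed through the
    unprimed ones.\<close>
  let ?h = "\<lambda>t. z (inv_into U' z' t)" and ?l = "\<lambda>t. l (inv_into U' z' t)"
  have hx: "?h (z' x) = z x" and lx: "?l (z' x) = l x"
    using c'(4) x(2) by auto
  have h: "?h analytic_on {z' x}" "deriv ?h (z' x) \<noteq> 0"
    using compatible_change_analytic[OF c'(1) c(1) x(2,1)]
      compatible_change_deriv_nonzero[OF c'(1) c(1) x(2,1)] by auto
  have l: "?l analytic_on {z' x}" "?l (z' x) \<noteq> 0"
    using holo_on_analytic[OF c'(1) N(1,4) x(2) N(2)] N(2,5) lx by auto
  obtain L :: "complex ^ ('n::{finite, linorder}) ^ ('n::{finite, linorder})" where L: "invertible L"
    and W: "\<forall>a b M. (\<forall>j. (\<lambda>s. a s $ j) analytic_on {?h (z' x)}) \<longrightarrow>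
      (\<forall>\<^sub>F s in nhds (z' x). b s = ?l s *s (a (?h s) v* M)) \<longrightarrow>
      wronski b (z' x) = L ** wronski a (?h (z' x)) ** M"
    by (rule wronski_transform[OF l h])
  show ?thesis
  proof (rule that[OF L N(6)])
    show "l x \<noteq> 0" "\<And>e. e \<in> fibre V x \<Longrightarrow> \<phi>' e = l x *s (\<phi> e v* M)"
      using N by auto
    fix A assume A: "is_section A" "analytic_in U z \<phi> A x"
    have a: "(\<lambda>s. \<phi> (A (inv_into U z s)) $ j) analytic_on {?h (z' x)}" for j
      using A(2) by (simp add: analytic_in_def hx)
    have b: "\<forall>\<^sub>F s in nhds (z' x). \<phi>' (A (inv_into U' z' s))
        = ?l s *s (\<phi> (A (inv_into U z (?h s))) v* M)"
      using eventually_inv_into_chart[OF c'(2) N(1) x(2) N(2)]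
    proof eventually_elim
      case (elim s)
      define y where "y = inv_into U' z' s"
      have y: "y \<in> N" "y \<in> U"
        using elim N(3) by (auto simp: y_def)
      then have "A y \<in> fibre V y" "inv_into U z (z y) = y"
        using A(1) c by (auto simp: is_section_def)
      with N(7) y show ?case
        by (simp add: y_def)
    qed
    show "analytic_in U' z' \<phi>' A x \<and>
      wronskian_matrix U' z' \<phi>' A (z' x) = L ** wronskian_matrix U z \<phi> A (z x) ** M"
      using W[rule_format, OF a b] analytic_scale_compose[OF l(1) h(1) a b] hx
      by (simp add: analytic_in_def wronskian_matrix_eq_wronski)
  qed
qed

lemma wronskian_matrix_scale:
  assumes "coord_chart X U z" "linear_triv V U \<phi>" and x: "x \<in> U"
    and f: "(\<lambda>t. f (inv_into U z t)) analytic_on {z x}" "f x \<noteq> 0"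
  obtains L :: "complex ^ ('n::{finite, linorder}) ^ ('n::{finite, linorder})"
  where "invertible L"
    "\<And>A. is_section A \<Longrightarrow> analytic_in U z \<phi> A x \<Longrightarrow> analytic_in U z \<phi> (scale_section V f A) x \<and>
      wronskian_matrix U z \<phi> (scale_section V f A) (z x) = L ** wronskian_matrix U z \<phi> A (z x)"
proof -
  note c = coord_chartD[OF assms(1)]
  let ?l = "\<lambda>t. f (inv_into U z t)"
  have l: "?l (z x) \<noteq> 0"
    using c(4) x f(2) by simp
  have h: "(\<lambda>t. t) analytic_on {z x}" "deriv (\<lambda>t. t) (z x) \<noteq> 0"
    by auto
  obtain L :: "complex ^ ('n::{finite, linorder}) ^ ('n::{finite, linorder})" where L: "invertible L"
    and W: "\<forall>a b M. (\<forall>j. (\<lambda>s. a s $ j) analytic_on {z x}) \<longrightarrow>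
      (\<forall>\<^sub>F s in nhds (z x). b s = ?l s *s (a s v* M)) \<longrightarrow> wronski b (z x) = L ** wronski a (z x) ** M"
    by (rule wronski_transform[OF f(1) l h])
  show ?thesis
  proof (rule that[OF L])
    fix A assume A: "is_section A" "analytic_in U z \<phi> A x"
    have a: "(\<lambda>s. \<phi> (A (inv_into U z s)) $ j) analytic_on {z x}" for j
      using A(2) by (simp add: analytic_in_def)
    have b: "\<forall>\<^sub>F s in nhds (z x). \<phi> (scale_section V f A (inv_into U z s))
        = ?l s *s (\<phi> (A (inv_into U z s)) v* mat 1)"
      using eventually_inv_into_chart[OF c(2,3) x x]
    proof eventually_elim
      case (elim s)
      then have "A (inv_into U z s) \<in> fibre V (inv_into U z s)"
        using A(1) c(5) by (auto simp: is_section_def)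
      with elim show ?case
        using linear_triv_smul(2)[OF assms(2), of "inv_into U z s"] by (simp add: scale_section_def)
    qed
    show "analytic_in U z \<phi> (scale_section V f A) x \<and>
      wronskian_matrix U z \<phi> (scale_section V f A) (z x) = L ** wronskian_matrix U z \<phi> A (z x)"
      using W[rule_format, OF a b] analytic_scale_compose[OF f(1) h(1) a b]
      by (simp add: analytic_in_def wronskian_matrix_eq_wronski)
  qed
qed

text \<open>
  By \<open>wronskian_matrix_change\<close> these two conditions do not depend on the chart and the trivialization
  in which they are tested.
\<close>

definition analytic_point :: "('a \<Rightarrow> 'v) \<Rightarrow> 'a \<Rightarrow> bool" where
  "analytic_point A x \<longleftrightarrow>
     (\<exists>U z \<phi>. coord_chart X U z \<and> pf_triv X V P U \<phi> \<and> x \<in> U \<and> analytic_in U z \<phi> A x)"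

definition regular_point :: "('a \<Rightarrow> 'v) \<Rightarrow> 'a \<Rightarrow> bool" where
  "regular_point A x \<longleftrightarrow>
     (\<exists>U z \<phi>. coord_chart X U z \<and> pf_triv X V P U \<phi> \<and> x \<in> U \<and> analytic_in U z \<phi> A x \<and>
        invertible (wronskian_matrix U z \<phi> A (z x)))"

lemma analytic_pointD:
  assumes "is_section A" "analytic_point A x" "coord_chart X U z" "pf_triv X V P U \<phi>" "x \<in> U"
  shows "analytic_in U z \<phi> A x"
proof -
  obtain U' z' \<phi>' where *: "coord_chart X U' z'" "pf_triv X V P U' \<phi>'" "x \<in> U'" "analytic_in U' z' \<phi>' A x"
    using assms(2) unfolding analytic_point_def by blast
  show ?thesis
    by (rule wronskian_matrix_change[OF *(1,2) assms(3,4) *(3) assms(5)]) (use assms(1) *(4) in blast)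
qed

lemma regular_pointD:
  assumes "is_section A" "regular_point A x" "coord_chart X U z" "pf_triv X V P U \<phi>" "x \<in> U"
  shows "analytic_in U z \<phi> A x" "invertible (wronskian_matrix U z \<phi> A (z x))"
proof -
  obtain U' z' \<phi>' where *: "coord_chart X U' z'" "pf_triv X V P U' \<phi>'" "x \<in> U'" "analytic_in U' z' \<phi>' A x"
    "invertible (wronskian_matrix U' z' \<phi>' A (z' x))"
    using assms(2) unfolding regular_point_def by blast
  obtain c and L M :: "complex ^ ('n::{finite, linorder}) ^ ('n::{finite, linorder})"
    where LM: "invertible L" "invertible M" "analytic_in U z \<phi> A x \<and>
      wronskian_matrix U z \<phi> A (z x) = L ** wronskian_matrix U' z' \<phi>' A (z' x) ** M"
    by (rule wronskian_matrix_change[OF *(1,2) assms(3,4) *(3) assms(5)]) (use assms(1) *(4) in blast)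
  then show "analytic_in U z \<phi> A x" "invertible (wronskian_matrix U z \<phi> A (z x))"
    using *(5) by (auto intro!: invertible_mult)
qed

text \<open>The two quotient matrices satisfy M Q' = Q M, where \<open>M\<close> is the constant
  part of the transition; this is the statement that both describe the same endomorphism of the
  fibre.\<close>

lemma local_wronskian_quotient_unique:
  assumes "coord_chart X U z" "pf_triv X V P U \<phi>" "coord_chart X U' z'" "pf_triv X V P U' \<phi>'"
    and x: "x \<in> U" "x \<in> U'" and "is_section A" "is_section B" "analytic_point A x" "regular_point B x"
    and e: "e \<in> fibre V x"
  shows "local_wronskian_quotient V U z \<phi> A B x e = local_wronskian_quotient V U' z' \<phi>' A B x e"
proof -
  let ?W = "wronskian_matrix U z \<phi>" and ?W' = "wronskian_matrix U' z' \<phi>'"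
  let ?q = "local_wronskian_quotient V U z \<phi> A B x" and ?q' = "local_wronskian_quotient V U' z' \<phi>' A B x"
  obtain c and L M :: "complex ^ ('n::{finite, linorder}) ^ ('n::{finite, linorder})"
    where LM: "invertible L" "invertible M" "c \<noteq> 0" "\<And>e. e \<in> fibre V x \<Longrightarrow> \<phi>' e = c *s (\<phi> e v* M)"
      and W: "\<And>A. is_section A \<Longrightarrow> analytic_in U z \<phi> A x \<Longrightarrow> analytic_in U' z' \<phi>' A x \<and>
        ?W' A (z' x) = L ** ?W A (z x) ** M"
    using wronskian_matrix_change[OF assms(1-4) x] by metis
  have A: "?W' A (z' x) = L ** ?W A (z x) ** M"
    using W assms(7) analytic_pointD[OF assms(7,9,1,2) x(1)] by blast
  have B: "?W' B (z' x) = L ** ?W B (z x) ** M" "invertible (?W B (z x))"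
    using W assms(8) regular_pointD[OF assms(8,10,1,2) x(1)] by blast+
  \<comment> \<open>The inverse of L W(B) M ends in L^-1, which meets the \<open>L\<close> in front
    of W(A).\<close>
  have "wronskian_quotient_matrix U' z' \<phi>' A B (z' x)
      = matrix_inv M ** matrix_inv (?W B (z x)) ** (matrix_inv L ** L) ** ?W A (z x) ** M"
    unfolding wronskian_quotient_matrix_def A B
    by (simp add: matrix_inv_mult LM B invertible_mult matrix_mul_assoc)
  then have Q: "M ** wronskian_quotient_matrix U' z' \<phi>' A B (z' x)
      = (M ** matrix_inv M) ** wronskian_quotient_matrix U z \<phi> A B (z x) ** M"
    by (simp add: wronskian_quotient_matrix_def matrix_mul_assoc matrix_inv_left LM)
  note lt = pf_trivD(3)[OF assms(2)] and lt' = pf_trivD(3)[OF assms(4)]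
  have q: "?q e \<in> fibre V x" "\<phi> (?q e) = \<phi> e v* wronskian_quotient_matrix U z \<phi> A B (z x)"
    by (simp_all add: local_wronskian_quotient_def linear_triv_inv[OF lt x(1)])
  have q': "?q' e \<in> fibre V x" "\<phi>' (?q' e) = \<phi>' e v* wronskian_quotient_matrix U' z' \<phi>' A B (z' x)"
    by (simp_all add: local_wronskian_quotient_def linear_triv_inv[OF lt' x(2)])
  \<comment> \<open>The two images of \<open>e\<close> are compared in \<phi>'. By linearity the
    scalar \<open>c\<close> passes through the matrices and occurs equally on both sides.\<close>
  have "\<phi>' (?q' e) = c *s (\<phi> e v* (M ** wronskian_quotient_matrix U' z' \<phi>' A B (z' x)))"
    by (simp add: q'(2) LM(4) e scalar_vector_matrix_assoc vector_matrix_mul_assoc)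
  also have "\<dots> = \<phi>' (?q e)"
    by (simp add: Q matrix_inv_right LM(2,4) q vector_matrix_mul_assoc)
  finally show ?thesis
    using linear_triv_inj[OF lt' x(2) q(1) q'(1)] by simp
qed


section \<open>Meromorphic sections\<close>

lemma meromorphic_is_section: "meromorphic_section X V A \<Longrightarrow> is_section A"
  by (simp add: meromorphic_section_def is_section_def)

lemma generic_is_section: "generic_section X V P A \<Longrightarrow> is_section A"
  by (simp add: generic_section_def meromorphic_is_section)

lemma meromorphic_section_component:
  fixes \<phi> :: "'v \<Rightarrow> complex ^ ('n::{finite, linorder})"
  assumes "meromorphic_section X V A" "coord_chart X U z" "holo_triv X V U \<phi>" "x \<in> U"
  shows "(\<lambda>t. \<phi> (A (inv_into U z t)) $ j) meromorphic_on {z x}"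
proof -
  have "(\<lambda>t. \<phi> (A (inv_into U z t)) $ j) meromorphic_on z ` U"
    using assms by (simp add: meromorphic_section_def)
  then show ?thesis
    by (rule meromorphic_on_subset) (use assms(4) in auto)
qed

lemma meromorphic_wronskian_matrix:
  fixes \<phi> :: "'v \<Rightarrow> complex ^ ('n::{finite, linorder})"
  assumes "meromorphic_section X V A" "coord_chart X U z" "holo_triv X V U \<phi>" "x \<in> U"
  shows "(\<lambda>t. wronskian_matrix U z \<phi> A t $ i $ j) meromorphic_on {z x}"
  using meromorphic_section_component[OF assms]
  by (simp add: wronskian_matrix_def meromorphic_on_higher_deriv)

lemma eventually_analytic_in:
  assumes "meromorphic_section X V A" "coord_chart X U z" "holo_triv X V U \<phi>" "x \<in> U"
  shows "\<forall>\<^sub>F y in atin T x. y \<in> U \<and> analytic_in U z \<phi> A y"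
proof -
  note c = coord_chartD[OF assms(2)]
  have "\<forall>\<^sub>F s in at (z x). \<forall>j. (\<lambda>t. \<phi> (A (inv_into U z t)) $ j) analytic_on {s}"
    by (intro eventually_all_finite meromorphic_eventually_analytic meromorphic_section_component assms)
  with eventually_nhds_at[OF eventually_inv_into_chart[OF c(2,3) assms(4,4)]]
  have "\<forall>\<^sub>F s in at (z x). inv_into U z s \<in> U \<and> analytic_in U z \<phi> A (inv_into U z s)"
    by eventually_elim (simp add: analytic_in_def)
  then show ?thesis
    by (simp add: eventually_chart[OF c(2) assms(4)])
qed

lemma eventually_analytic_point:
  assumes "meromorphic_section X V A" "x \<in> topspace T"
  shows "\<forall>\<^sub>F y in atin T x. analytic_point A y"
proof -
  obtain W z \<phi> where W: "x \<in> W" "coord_chart X W z" "pf_triv X V P W \<phi>"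
    using assms(2) by (rule pf_chart_exists)
  from eventually_analytic_in[OF assms(1) W(2) pf_trivD(1)[OF W(3)] W(1)] show ?thesis
    by eventually_elim (use W in \<open>auto simp: analytic_point_def\<close>)
qed

text \<open>Regularity refers to arbitrary charts, but near \<open>x\<close> it can be tested in one
  fixed chart, where it means that a meromorphic determinant is nonzero.\<close>

lemma eventually_regular_or_not_regular:
  assumes A: "meromorphic_section X V A" and "x \<in> topspace T"
  shows "(\<forall>\<^sub>F y in atin T x. regular_point A y) \<or> (\<forall>\<^sub>F y in atin T x. \<not> regular_point A y)"
proof -
  obtain W z \<phi> where W: "x \<in> W" "coord_chart X W z" "pf_triv X V P W \<phi>"
    using assms(2) by (rule pf_chart_exists)
  let ?w = "\<lambda>t. det (wronskian_matrix W z \<phi> A t)"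
  note c = coord_chartD[OF W(2)] and \<phi> = pf_trivD(1)[OF W(3)]
  \<comment> \<open>Near \<open>x\<close> the components are analytic in the fixed chart, so only
    the determinant decides.\<close>
  have iff: "\<forall>\<^sub>F y in atin T x. regular_point A y \<longleftrightarrow> ?w (z y) \<noteq> 0"
    using eventually_analytic_in[OF A W(2) \<phi> W(1)]
  proof eventually_elim
    case (elim y)
    show ?case
    proof
      assume "regular_point A y"
      then show "?w (z y) \<noteq> 0"
        using regular_pointD(2)[OF meromorphic_is_section[OF A] _ W(2,3)] elim invertible_det_nz by blast
    next
      assume "?w (z y) \<noteq> 0"
      then show "regular_point A y"
        unfolding regular_point_def invertible_det_nz using elim W(2,3) by blast
    qed
  qed
  have "?w meromorphic_on {z x}"
    by (intro meromorphic_det meromorphic_wronskian_matrix[OF A W(2) \<phi> W(1)])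
  from meromorphic_eventually_zero_or_nonzero[OF this]
  have "(\<forall>\<^sub>F y in atin T x. ?w (z y) = 0) \<or> (\<forall>\<^sub>F y in atin T x. ?w (z y) \<noteq> 0)"
  proof (elim disjE)
    assume "\<forall>\<^sub>F t in at (z x). ?w t = 0"
    with eventually_nhds_at[OF eventually_inv_into_chart[OF c(2,3) W(1,1)]]
    have "\<forall>\<^sub>F t in at (z x). ?w (z (inv_into W z t)) = 0"
      by eventually_elim simp
    then show ?thesis
      by (simp add: eventually_chart[OF c(2) W(1)])
  next
    assume "\<forall>\<^sub>F t in at (z x). ?w t \<noteq> 0"
    with eventually_nhds_at[OF eventually_inv_into_chart[OF c(2,3) W(1,1)]]
    have "\<forall>\<^sub>F t in at (z x). ?w (z (inv_into W z t)) \<noteq> 0"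
      by eventually_elim simp
    then show ?thesis
      by (simp add: eventually_chart[OF c(2) W(1)])
  qed
  then show ?thesis
  proof (elim disjE)
    assume "\<forall>\<^sub>F y in atin T x. ?w (z y) = 0"
    with iff have "\<forall>\<^sub>F y in atin T x. \<not> regular_point A y"
      by eventually_elim simp
    then show ?thesis ..
  next
    assume "\<forall>\<^sub>F y in atin T x. ?w (z y) \<noteq> 0"
    with iff have "\<forall>\<^sub>F y in atin T x. regular_point A y"
      by eventually_elim simp
    then show ?thesis ..
  qed
qed

text \<open>\<open>generic_section\<close> gives information in one chart only; this spreads it over
  the surface, and so W(B) can be inverted near, though perhaps not at, every point of every
  projectively flat chart.\<close>

lemma generic_eventually_regular:
  assumes B: "generic_section X V P B" and "x \<in> topspace T"
  shows "\<forall>\<^sub>F y in atin T x. regular_point B y"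
proof -
  have mB: "meromorphic_section X V B"
    using B by (simp add: generic_section_def)
  obtain U z \<phi> x0 where U: "coord_chart X U z" "pf_triv X V P U \<phi>" "x0 \<in> U"
    "\<not> (\<forall>\<^sub>F y in atin T x0. wronskian U z \<phi> B (z y) = 0)"
    using B by (auto simp: generic_section_def mero_ae_def)
  have x0: "x0 \<in> topspace T"
    using U(3) coord_chartD(5)[OF U(1)] by blast
  \<comment> \<open>Where \<open>B\<close> is analytic, a non-regular point is a zero of w(B); if
    such points filled a punctured neighbourhood of \<open>x0\<close>, this would contradict the
    choice of \<open>x0\<close>.\<close>
  have "\<not> (\<forall>\<^sub>F y in atin T x0. \<not> regular_point B y)"
  proof
    assume "\<forall>\<^sub>F y in atin T x0. \<not> regular_point B y"
    with eventually_analytic_in[OF mB U(1) pf_trivD(1)[OF U(2)] U(3)]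
    have "\<forall>\<^sub>F y in atin T x0. wronskian U z \<phi> B (z y) = 0"
    proof eventually_elim
      case (elim y)
      show ?case
      proof (rule ccontr)
        assume "wronskian U z \<phi> B (z y) \<noteq> 0"
        then have "regular_point B y"
          unfolding regular_point_def invertible_det_nz wronskian_def using elim U(1,2) by blast
        with elim show False
          by blast
      qed
    qed
    with U(4) show False
      by blast
  qed
  moreover have "connected_space T"
    using riemann_surface by (simp add: riemann_surface_def)
  ultimately show ?thesis
    using eventually_regular_or_not_regular[OF mB] t1_space_surface topspace_atin_neq_bot x0 assms(2)
      connected_space_eventually_dichotomy[of T "regular_point B" x0 x] by blast
qed

text \<open>The converse passage, from regularity near one point to genericity; it serves to show
  that a scaled section is again generic.\<close>

lemma generic_sectionI:
  assumes A: "meromorphic_section X V A" and "x \<in> topspace T" and "\<forall>\<^sub>F y in atin T x. regular_point A y"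
  shows "generic_section X V P A"
proof -
  obtain W z \<phi> where W: "x \<in> W" "coord_chart X W z" "pf_triv X V P W \<phi>"
    using assms(2) by (rule pf_chart_exists)
  have nz: "\<forall>\<^sub>F y in atin T x. wronskian W z \<phi> A (z y) \<noteq> 0"
    using assms(3) eventually_atin_openin[OF coord_chartD(3)[OF W(2)] W(1)]
  proof eventually_elim
    case (elim y)
    then show ?case
      using regular_pointD(2)[OF meromorphic_is_section[OF A] _ W(2,3)]
      unfolding wronskian_def invertible_det_nz by blast
  qed
  have "\<not> (\<forall>\<^sub>F y in atin T x. wronskian W z \<phi> A (z y) = 0)"
  proof
    assume "\<forall>\<^sub>F y in atin T x. wronskian W z \<phi> A (z y) = 0"
    with nz have "\<forall>\<^sub>F y in atin T x. False"
      by eventually_elim simp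
    then show False
      using topspace_atin_neq_bot[OF assms(2)] by (simp add: eventually_False)
  qed
  with W A show ?thesis
    unfolding generic_section_def mero_ae_def by blast
qed

section \<open>The Wronskian quotient as an endomorphism\<close>

text \<open>A trivialization is injective on fibres, so two endomorphisms with a common matrix agree
  there. Equations of endomorphisms thereby reduce to matrix identities in projectively flat
  charts.\<close>

lemma endo_eqI:
  assumes "\<And>x. x \<in> topspace T \<Longrightarrow> fibre_endo V x (Q x)" "\<And>x. x \<in> topspace T \<Longrightarrow> fibre_endo V x (Q' x)"
    and ev: "\<And>x U z \<phi>. coord_chart X U z \<Longrightarrow> pf_triv X V P U \<phi> \<Longrightarrow> x \<in> U \<Longrightarrow>
      \<forall>\<^sub>F y in atin T x. \<exists>M. matrix_of_endo V \<phi> y (Q y) M \<and> matrix_of_endo V \<phi> y (Q' y) M"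
  shows "endo_eq X V (topspace T) Q Q'"
  unfolding endo_eq_def mero_ae_def
proof
  fix x assume "x \<in> topspace T"
  then obtain U z \<phi> where U: "x \<in> U" "coord_chart X U z" "pf_triv X V P U \<phi>"
    by (rule pf_chart_exists)
  from ev[OF U(2,3,1)] eventually_atin_openin[OF coord_chartD(3)[OF U(2)] U(1)]
  show "\<forall>\<^sub>F y in atin T x. \<forall>e\<in>fibre V y. Q y e = Q' y e"
  proof eventually_elim
    case (elim y)
    then obtain M where M: "matrix_of_endo V \<phi> y (Q y) M" "matrix_of_endo V \<phi> y (Q' y) M"
      by blast
    have y: "y \<in> topspace T"
      using elim coord_chartD(5)[OF U(2)] by blast
    show ?case
    proof
      fix e assume e: "e \<in> fibre V y"
      then have "Q y e \<in> fibre V y" "Q' y e \<in> fibre V y"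
        using assms(1,2)[OF y] unfolding fibre_endo_def by blast+
      then show "Q y e = Q' y e"
        using M e elim linear_triv_inj[OF pf_trivD(3)[OF U(3)]] by (simp add: matrix_of_endo_def)
    qed
  qed
qed

lemma is_wronskian_quotientD:
  assumes "is_wronskian_quotient X V P A B Q"
  shows "x \<in> topspace T \<Longrightarrow> fibre_endo V x (Q x)"
    and "coord_chart X U z \<Longrightarrow> pf_triv X V P U \<phi> \<Longrightarrow> x \<in> U \<Longrightarrow>
      \<forall>\<^sub>F y in atin T x. matrix_of_endo V \<phi> y (Q y) (wronskian_quotient_matrix U z \<phi> A B (z y))"
  using assms unfolding is_wronskian_quotient_def meromorphic_endo_def mero_ae_def by blast+

lemma is_wronskian_quotient_unique:
  assumes "is_wronskian_quotient X V P A B Q" "is_wronskian_quotient X V P A B Q'"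
  shows "endo_eq X V (topspace T) Q Q'"
proof (rule endo_eqI)
  fix x U z \<phi> assume U: "coord_chart X U z" "pf_triv X V P U \<phi>" "x \<in> U"
  from is_wronskian_quotientD(2)[OF assms(1) U] is_wronskian_quotientD(2)[OF assms(2) U]
  show "\<forall>\<^sub>F y in atin T x. \<exists>M. matrix_of_endo V \<phi> y (Q y) M \<and> matrix_of_endo V \<phi> y (Q' y) M"
    by eventually_elim blast
qed (use assms is_wronskian_quotientD(1) in blast)+

text \<open>
  The chart and trivialization are chosen separately at each point; at the points where \<open>A\<close> is analytic
  and \<open>B\<close> is regular the choice does not matter, by \<open>local_wronskian_quotient_unique\<close>.
\<close>

definition quotient_endo :: "('a \<Rightarrow> 'v) \<Rightarrow> ('a \<Rightarrow> 'v) \<Rightarrow> 'a \<Rightarrow> 'v \<Rightarrow> 'v" where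
  "quotient_endo A B x = (SOME q. \<exists>U z \<phi>. coord_chart X U z \<and> pf_triv X V P U \<phi> \<and> x \<in> U \<and>
     q = local_wronskian_quotient V U z \<phi> A B x)"

lemma quotient_endo_local:
  assumes "x \<in> topspace T"
  obtains U z \<phi> where "coord_chart X U z" "pf_triv X V P U \<phi>" "x \<in> U"
    "quotient_endo A B x = local_wronskian_quotient V U z \<phi> A B x"
proof -
  have "\<exists>q U z \<phi>. coord_chart X U z \<and> pf_triv X V P U \<phi> \<and> x \<in> U \<and>
     q = local_wronskian_quotient V U z \<phi> A B x"
    by (rule pf_chart_exists[OF assms]) blast
  then have "\<exists>U z \<phi>. coord_chart X U z \<and> pf_triv X V P U \<phi> \<and> x \<in> U \<and>
     quotient_endo A B x = local_wronskian_quotient V U z \<phi> A B x"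
    unfolding quotient_endo_def by (rule someI_ex)
  with that show ?thesis
    by blast
qed

lemma fibre_endo_quotient_endo:
  assumes "x \<in> topspace T"
  shows "fibre_endo V x (quotient_endo A B x)"
proof -
  obtain U z \<phi> where U: "coord_chart X U z" "pf_triv X V P U \<phi>" "x \<in> U"
    "quotient_endo A B x = local_wronskian_quotient V U z \<phi> A B x"
    using assms by (rule quotient_endo_local)
  have "local_wronskian_quotient V U z \<phi> A B x
      = (\<lambda>e. inv_into (fibre V x) \<phi> (\<phi> e v* wronskian_quotient_matrix U z \<phi> A B (z x)))"
    by (simp add: local_wronskian_quotient_def fun_eq_iff)
  then show ?thesis
    using fibre_endo_linear_triv[OF pf_trivD(3)[OF U(2)] U(3)] U(4) by simp
qed

lemma eventually_matrix_of_quotient_endo: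
  assumes A: "meromorphic_section X V A" and B: "generic_section X V P B"
    and U: "coord_chart X U z" "pf_triv X V P U \<phi>" "x \<in> U"
  shows "\<forall>\<^sub>F y in atin T x. y \<in> U \<and>
    matrix_of_endo V \<phi> y (quotient_endo A B y) (wronskian_quotient_matrix U z \<phi> A B (z y))"
proof -
  have x: "x \<in> topspace T"
    using coord_chartD(5)[OF U(1)] U(3) by blast
  from eventually_analytic_point[OF A x] generic_eventually_regular[OF B x]
    eventually_atin_openin[OF coord_chartD(3)[OF U(1)] U(3)]
  show ?thesis
  proof eventually_elim
    case (elim y)
    have "y \<in> topspace T"
      using coord_chartD(5)[OF U(1)] elim by blast
    then obtain U' z' \<phi>' where U': "coord_chart X U' z'" "pf_triv X V P U' \<phi>'" "y \<in> U'"
      "quotient_endo A B y = local_wronskian_quotient V U' z' \<phi>' A B y"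
      by (rule quotient_endo_local)
    have "\<forall>e\<in>fibre V y. local_wronskian_quotient V U z \<phi> A B y e = quotient_endo A B y e"
      using local_wronskian_quotient_unique[OF U(1,2) U'(1,2)] elim U'(3,4)
        meromorphic_is_section[OF A] generic_is_section[OF B] by auto
    from matrix_of_endo_cong[OF this matrix_of_endo_local_quotient[OF pf_trivD(3)[OF U(2)]]] elim
    show ?case
      by blast
  qed
qed

lemma meromorphic_wronskian_quotient_matrix:
  fixes \<phi> :: "'v \<Rightarrow> complex ^ ('n::{finite, linorder})"
  assumes A: "meromorphic_section X V A" and B: "generic_section X V P B"
    and U: "coord_chart X U z" "pf_triv X V P U \<phi>" "x \<in> U"
  shows "(\<lambda>t. wronskian_quotient_matrix U z \<phi> A B t $ i $ j) meromorphic_on {z x}"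
proof -
  note c = coord_chartD[OF U(1)] and \<phi> = pf_trivD(1)[OF U(2)]
  have x: "x \<in> topspace T"
    using c(5) U(3) by blast
  have mB: "meromorphic_section X V B"
    using B by (simp add: generic_section_def)
  have "\<forall>\<^sub>F t in at (z x). regular_point B (inv_into U z t)"
    using generic_eventually_regular[OF B x] by (simp add: eventually_chart[OF c(2) U(3)])
  with eventually_nhds_at[OF eventually_inv_into_chart[OF c(2,3) U(3,3)]]
  have "\<forall>\<^sub>F t in at (z x). invertible (wronskian_matrix U z \<phi> B t)"
  proof eventually_elim
    case (elim t)
    then show ?case
      using regular_pointD(2)[OF meromorphic_is_section[OF mB] _ U(1,2), of "inv_into U z t"] by simp
  qed
  then show ?thesis
    unfolding wronskian_quotient_matrix_def
    by (intro meromorphic_matrix_mult meromorphic_matrix_inv meromorphic_wronskian_matrix A mB U \<phi>)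
qed

section \<open>Meromorphy in arbitrary holomorphic trivializations\<close>

lemma holo_triv_transition:
  assumes "holo_triv X V U \<phi>" "(U', \<phi>') \<in> trivs V"
  obtains g :: "'a \<Rightarrow> complex ^ ('n::{finite, linorder}) ^ ('n::{finite, linorder})"
  where "\<forall>i j. holo_on X (U \<inter> U') (\<lambda>x. g x $ i $ j)" "\<forall>x\<in>U \<inter> U'. invertible (g x)"
    "\<forall>x\<in>U \<inter> U'. \<forall>e\<in>fibre V x. \<phi> e = \<phi>' e v* g x"
proof -
  have "holo_transition X V U \<phi> U' \<phi>'"
    using assms unfolding holo_triv_def by blast
  with that show ?thesis
    unfolding holo_transition_def by blast
qed

text \<open>The trivialization \<phi> is merely holomorphic, so its matrix of the quotient is not a
  Wronskian quotient. Near each point it is a conjugate of one by holomorphic matrices, hence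
  meromorphic.\<close>

lemma meromorphic_endo_quotient_endo:
  assumes A: "meromorphic_section X V A" and B: "generic_section X V P B"
  shows "meromorphic_endo X V (quotient_endo A B)"
  unfolding meromorphic_endo_def
proof (intro conjI ballI allI impI)
  let ?Q = "quotient_endo A B"
  show "fibre_endo V x (?Q x)" if "x \<in> topspace T" for x
    using that by (rule fibre_endo_quotient_endo)
  fix U z and \<phi> :: "'v \<Rightarrow> complex ^ ('n::{finite, linorder})"
  assume U: "coord_chart X U z" and \<phi>: "holo_triv X V U \<phi>"
  note c = coord_chartD[OF U]
  have lt: "linear_triv V U \<phi>"
    using \<phi> by (simp add: holo_triv_def)
  \<comment> \<open>Linear algebra provides a matrix at every point of \<open>U\<close>, including
    points where \<open>A\<close> or \<open>B\<close> has a pole or W(B) is singular.\<close>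
  have "\<exists>M. matrix_of_endo V \<phi> x (?Q x) M" if "x \<in> U" for x
    using fibre_endo_has_matrix[OF lt that fibre_endo_quotient_endo] that c(5) by blast
  then obtain N where N: "\<And>x. x \<in> U \<Longrightarrow> matrix_of_endo V \<phi> x (?Q x) (N x)"
    by metis
  have mero: "(\<lambda>t. N (inv_into U z t) $ i $ j) meromorphic_on {z x}" if x: "x \<in> U" for x i j
  proof -
    \<comment> \<open>The smaller chart keeps the coordinate \<open>z\<close>, so the matrices in
      \<phi> and \<psi> are functions of the same variable.\<close>
    obtain W \<psi> where W: "x \<in> W" "W \<subseteq> U" "coord_chart X W z" "pf_triv X V P W \<psi>"
      using pf_chart_exists_within[OF c(1) x] by metis
    note cW = coord_chartD[OF W(3)]
    obtain U' \<phi>' where U': "(U', \<phi>') \<in> trivs V" "x \<in> U'"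
      using vector_bundle c(5) x unfolding holomorphic_vector_bundle_def by blast
    have "openin T U'"
      using vector_bundle U'(1) unfolding holomorphic_vector_bundle_def by blast
    then have open_sets: "openin T (U \<inter> U')" "openin T (W \<inter> U')"
      using c(3) cW(3) by auto
    obtain g :: "'a \<Rightarrow> complex ^ ('n::{finite, linorder}) ^ ('n::{finite, linorder})"
      where g: "\<forall>i j. holo_on X (U \<inter> U') (\<lambda>x. g x $ i $ j)" "\<forall>x\<in>U \<inter> U'. invertible (g x)"
        "\<forall>x\<in>U \<inter> U'. \<forall>e\<in>fibre V x. \<phi> e = \<phi>' e v* g x"
      by (rule holo_triv_transition[OF \<phi> U'(1)])
    obtain k :: "'a \<Rightarrow> complex ^ ('n::{finite, linorder}) ^ ('n::{finite, linorder})"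
      where k: "\<forall>i j. holo_on X (W \<inter> U') (\<lambda>x. k x $ i $ j)" "\<forall>x\<in>W \<inter> U'. invertible (k x)"
        "\<forall>x\<in>W \<inter> U'. \<forall>e\<in>fibre V x. \<psi> e = \<phi>' e v* k x"
      by (rule holo_triv_transition[OF pf_trivD(1)[OF W(4)] U'(1)])
    let ?i = "inv_into U z" and ?q = "wronskian_quotient_matrix W z \<psi> A B"
    \<comment> \<open>From \<phi> = \<phi>' g and \<psi> = \<phi>' k follows \<psi> = \<phi> g^-1 k,
      so a matrix \<open>q\<close> in \<psi> becomes g^-1 k q k^-1 g in \<phi>. Agreement of
      \<open>?R\<close> with \<open>N\<close> on a punctured neighbourhood is enough for
      meromorphy.\<close>
    let ?R = "\<lambda>t. matrix_inv (g (?i t)) ** k (?i t) ** ?q t ** matrix_inv (k (?i t)) ** g (?i t)"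
    have near: "\<forall>\<^sub>F t in at (z x). ?i t \<in> W \<and> ?i t \<in> U' \<and> z (?i t) = t"
      using eventually_nhds_at[OF eventually_inv_into_chart[OF c(2) open_sets(2) x]] W(1) U'(2)
      by (auto elim: eventually_mono)
    have "(\<lambda>t. g (?i t) $ i $ j) meromorphic_on {z x}" "(\<lambda>t. k (?i t) $ i $ j) meromorphic_on {z x}" for i j
      using holo_on_analytic[OF c(1) open_sets(1) g(1)[rule_format] x] holo_on_analytic[OF c(1) open_sets(2) k(1)[rule_format] x]
        x W(1) U'(2) by (auto intro: analytic_on_imp_meromorphic_on)
    moreover have "\<forall>\<^sub>F t in at (z x). invertible (g (?i t))" "\<forall>\<^sub>F t in at (z x). invertible (k (?i t))"
      using near by (eventually_elim, use g(2) k(2) W(2) in blast)+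
    ultimately have "(\<lambda>t. ?R t $ i $ j) meromorphic_on {z x}"
      by (intro meromorphic_matrix_mult meromorphic_matrix_inv
          meromorphic_wronskian_quotient_matrix[OF A B W(3,4,1)])
    moreover have "\<forall>\<^sub>F t in at (z x). ?R t $ i $ j = N (?i t) $ i $ j"
    proof -
      have "\<forall>\<^sub>F t in at (z x). matrix_of_endo V \<psi> (?i t) (?Q (?i t)) (?q (z (?i t)))"
        using eventually_matrix_of_quotient_endo[OF A B W(3,4,1)]
        by (simp add: eventually_chart[OF c(2) x] eventually_conj_iff)
      with near show ?thesis
      proof eventually_elim
        case (elim t)
        define y where "y = ?i t"
        have y: "y \<in> U" "y \<in> W" "y \<in> U'" "y \<in> topspace T"
          using elim W(2) c(5) by (auto simp: y_def)
        have gk: "invertible (g y)" "invertible (k y)"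
          using g(2) k(2) y by auto
        have "matrix_of_endo V \<phi> y (?Q y) (?R t)"
          unfolding matrix_of_endo_def
        proof
          fix e assume e: "e \<in> fibre V y"
          have Qe: "?Q y e \<in> fibre V y"
            using fibre_endo_quotient_endo[OF y(4)] e unfolding fibre_endo_def by blast
          have "\<psi> (?Q y e) = \<psi> e v* ?q t"
            using elim e by (simp add: matrix_of_endo_def y_def)
          then have "\<phi>' (?Q y e) v* k y = \<phi>' e v* k y v* ?q t"
            using k(3) y e Qe by simp
          then have "\<phi>' (?Q y e) v* (k y ** matrix_inv (k y)) = \<phi>' e v* k y v* ?q t v* matrix_inv (k y)"
            by (simp flip: vector_matrix_mul_assoc)
          then have "\<phi>' (?Q y e) = \<phi>' e v* (k y ** ?q t ** matrix_inv (k y))"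
            by (simp add: matrix_inv_right[OF gk(2)] vector_matrix_mul_assoc)
          then have 1: "\<phi> (?Q y e) = \<phi>' e v* (k y ** ?q t ** matrix_inv (k y) ** g y)"
            using g(3) y Qe by (simp add: vector_matrix_mul_assoc)
          have "\<phi> e v* ?R t = \<phi>' e v* ((g y ** matrix_inv (g y)) ** k y ** ?q t ** matrix_inv (k y) ** g y)"
            using g(3) y e by (simp add: vector_matrix_mul_assoc matrix_mul_assoc flip: y_def)
          with 1 show "\<phi> (?Q y e) = \<phi> e v* ?R t"
            by (simp add: matrix_inv_right[OF gk(1)])
        qed
        then have "?R t = N y"
          using matrix_of_endo_unique[OF lt y(1)] N[OF y(1)] by blast
        then show ?case
          by (simp add: y_def)
      qed
    qed
    ultimately show ?thesis
      by (subst meromorphic_on_cong[OF _ refl, symmetric]) auto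
  qed
  show "\<exists>M :: complex \<Rightarrow> complex ^ ('n::{finite, linorder}) ^ ('n::{finite, linorder}).
     (\<forall>i j. (\<lambda>t. M t $ i $ j) meromorphic_on z ` U) \<and> (\<forall>x\<in>U. matrix_of_endo V \<phi> x (?Q x) (M (z x)))"
  proof (intro exI[of _ "\<lambda>t. N (inv_into U z t)"] conjI allI ballI)
    show "(\<lambda>t. N (inv_into U z t) $ i $ j) meromorphic_on z ` U" for i j
      by (subst meromorphic_on_meromorphic_at) (use mero in blast)
    show "matrix_of_endo V \<phi> x (?Q x) (N (inv_into U z (z x)))" if "x \<in> U" for x
      using N that c(4) by simp
  qed
qed

text \<open>\<open>quotient_endo\<close> is the witness that justifies the choice operator in
  \<open>wronskian_quotient\<close>; the chosen representative may differ from it at exceptional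
  points.\<close>

lemma is_wronskian_quotient_wronskian_quotient:
  assumes "meromorphic_section X V A" "generic_section X V P B"
  shows "is_wronskian_quotient X V P A B (wronskian_quotient X V P A B)"
proof -
  have "is_wronskian_quotient X V P A B (quotient_endo A B)"
    unfolding is_wronskian_quotient_def mero_ae_def
  proof (intro conjI allI impI ballI)
    fix U z \<phi> x assume "coord_chart X U z" "pf_triv X V P U \<phi>" "x \<in> U"
    from eventually_matrix_of_quotient_endo[OF assms this]
    show "\<forall>\<^sub>F y in atin T x.
      matrix_of_endo V \<phi> y (quotient_endo A B y) (wronskian_quotient_matrix U z \<phi> A B (z y))"
      by eventually_elim blast
  qed (rule meromorphic_endo_quotient_endo[OF assms])
  then show ?thesis
    unfolding wronskian_quotient_def by (rule someI[where P = "is_wronskian_quotient X V P A B"])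
qed

section \<open>Independence of choices and the cyclic product\<close>

lemma endo_eq_local_wronskian_quotient:
  assumes A: "meromorphic_section X V A" and B: "generic_section X V P B"
    and U: "coord_chart X U z" "pf_triv X V P U \<phi>" and U': "coord_chart X U' z'" "pf_triv X V P U' \<phi>'"
  shows "endo_eq X V (U \<inter> U') (local_wronskian_quotient V U z \<phi> A B) (local_wronskian_quotient V U' z' \<phi>' A B)"
  unfolding endo_eq_def mero_ae_def
proof
  fix x assume x: "x \<in> U \<inter> U'"
  then have xT: "x \<in> topspace T"
    using coord_chartD(5)[OF U(1)] by blast
  have "openin T (U \<inter> U')"
    using coord_chartD(3)[OF U(1)] coord_chartD(3)[OF U'(1)] by auto
  from eventually_analytic_point[OF A xT] generic_eventually_regular[OF B xT]
    eventually_atin_openin[OF this x]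
  show "\<forall>\<^sub>F y in atin T x. \<forall>e\<in>fibre V y.
    local_wronskian_quotient V U z \<phi> A B y e = local_wronskian_quotient V U' z' \<phi>' A B y e"
  proof eventually_elim
    case (elim y)
    then show ?case
      using local_wronskian_quotient_unique[OF U U'] meromorphic_is_section[OF A] generic_is_section[OF B]
      by auto
  qed
qed

lemma wronskian_quotient_cycle:
  assumes "generic_section X V P A" "generic_section X V P B" "generic_section X V P C"
  shows "endo_eq X V (topspace T)
    (endo_mult (endo_mult (wronskian_quotient X V P A B) (wronskian_quotient X V P C A))
      (wronskian_quotient X V P B C)) endo_one"
proof -
  have m: "meromorphic_section X V A" "meromorphic_section X V B" "meromorphic_section X V C"
    using assms by (auto simp: generic_section_def)
  define Q where "Q = wronskian_quotient X V P A B"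
  define R where "R = wronskian_quotient X V P C A"
  define S where "S = wronskian_quotient X V P B C"
  have Q: "is_wronskian_quotient X V P A B Q" and R: "is_wronskian_quotient X V P C A R"
    and S: "is_wronskian_quotient X V P B C S"
    using is_wronskian_quotient_wronskian_quotient assms m by (auto simp: Q_def R_def S_def)
  have "endo_eq X V (topspace T) (endo_mult (endo_mult Q R) S) endo_one"
  proof (rule endo_eqI)
    fix x assume x: "x \<in> topspace T"
    show "fibre_endo V x (endo_one x)"
      by (simp add: fibre_endo_def endo_one_def)
    show "fibre_endo V x (endo_mult (endo_mult Q R) S x)"
      using is_wronskian_quotientD(1)[OF Q x] is_wronskian_quotientD(1)[OF R x]
        is_wronskian_quotientD(1)[OF S x]
      by (simp add: fibre_endo_def endo_mult_def)
  next
    fix x U z \<phi> assume U: "coord_chart X U z" "pf_triv X V P U \<phi>" "x \<in> U"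
    let ?W = "wronskian_matrix U z \<phi>"
    have x: "x \<in> topspace T"
      using coord_chartD(5)[OF U(1)] U(3) by blast
    from generic_eventually_regular[OF assms(1) x] generic_eventually_regular[OF assms(2) x]
      generic_eventually_regular[OF assms(3) x] is_wronskian_quotientD(2)[OF Q U]
      is_wronskian_quotientD(2)[OF R U] is_wronskian_quotientD(2)[OF S U]
      eventually_atin_openin[OF coord_chartD(3)[OF U(1)] U(3)]
    show "\<forall>\<^sub>F y in atin T x. \<exists>M. matrix_of_endo V \<phi> y (endo_mult (endo_mult Q R) S y) M \<and>
      matrix_of_endo V \<phi> y (endo_one y) M"
    proof eventually_elim
      case (elim y)
      have y: "y \<in> topspace T"
        using coord_chartD(5)[OF U(1)] elim by blast
      have inv: "invertible (?W A (z y))" "invertible (?W B (z y))" "invertible (?W C (z y))"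
        using regular_pointD(2)[OF generic_is_section[OF assms(1)] _ U(1,2)]
          regular_pointD(2)[OF generic_is_section[OF assms(2)] _ U(1,2)]
          regular_pointD(2)[OF generic_is_section[OF assms(3)] _ U(1,2)] elim by blast+
      let ?q = "\<lambda>A B. wronskian_quotient_matrix U z \<phi> A B (z y)"
      \<comment> \<open>In a single chart the product telescopes, W(B)^-1 W(A) W(A)^-1 W(C) W(C)^-1
        W(B), at points where all three sections are regular.\<close>
      have "?q A B ** ?q C A ** ?q B C = matrix_inv (?W B (z y)) **
          (?W A (z y) ** matrix_inv (?W A (z y))) ** (?W C (z y) ** matrix_inv (?W C (z y))) ** ?W B (z y)"
        by (simp only: wronskian_quotient_matrix_def matrix_mul_assoc)
      then have one: "?q A B ** ?q C A ** ?q B C = mat 1"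
        by (simp add: matrix_inv_right matrix_inv_left inv)
      \<comment> \<open>\<open>endo_mult\<close> applies its left factor first, which for matrices
        acting on row vectors is multiplication in the written order.\<close>
      have "matrix_of_endo V \<phi> y (endo_mult (endo_mult Q R) S y) (?q A B ** ?q C A ** ?q B C)"
        unfolding matrix_of_endo_def
      proof
        fix e assume e: "e \<in> fibre V y"
        have "Q y e \<in> fibre V y"
          using is_wronskian_quotientD(1)[OF Q y] e unfolding fibre_endo_def by blast
        moreover from this have "R y (Q y e) \<in> fibre V y"
          using is_wronskian_quotientD(1)[OF R y] unfolding fibre_endo_def by blast
        ultimately show "\<phi> (endo_mult (endo_mult Q R) S y e) = \<phi> e v* (?q A B ** ?q C A ** ?q B C)"
          using elim e by (simp add: matrix_of_endo_def endo_mult_def vector_matrix_mul_assoc)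
      qed
      moreover have "matrix_of_endo V \<phi> y (endo_one y) (mat 1)"
        by (simp add: matrix_of_endo_def endo_one_def)
      ultimately show ?case
        using one by auto
    qed
  qed
  then show ?thesis
    by (simp add: Q_def R_def S_def)
qed


section \<open>Scaling by a meromorphic function\<close>

lemma is_section_scale:
  assumes "is_section A"
  shows "is_section (scale_section V f A)"
  unfolding is_section_def
proof
  fix x assume x: "x \<in> topspace T"
  then obtain U z \<phi> where "x \<in> U" "coord_chart X U z" "pf_triv X V P U \<phi>"
    by (rule pf_chart_exists)
  then show "scale_section V f A x \<in> fibre V x"
    using assms x linear_triv_smul(1)[OF pf_trivD(3)] by (simp add: is_section_def scale_section_def)
qed

lemma meromorphic_section_scale:
  assumes A: "meromorphic_section X V A" and f: "meromorphic_fun X f"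
  shows "meromorphic_section X V (scale_section V f A)"
proof -
  have "(\<lambda>t. \<phi> (scale_section V f A (inv_into U z t)) $ j) meromorphic_on {z x}"
    if U: "coord_chart X U z" "holo_triv X V U \<phi>" and x: "x \<in> U"
    for U z x j and \<phi> :: "'v \<Rightarrow> complex ^ ('n::{finite, linorder})"
  proof -
    note c = coord_chartD[OF U(1)]
    have lt: "linear_triv V U \<phi>"
      using U(2) by (simp add: holo_triv_def)
    have "(\<lambda>t. f (inv_into U z t)) meromorphic_on {z x}"
      using meromorphic_fun_chart[OF c(1) f] by (rule meromorphic_on_subset) (use x in auto)
    then have "(\<lambda>t. f (inv_into U z t) * \<phi> (A (inv_into U z t)) $ j) meromorphic_on {z x}"
      by (intro meromorphic_intros meromorphic_section_component[OF A U x])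
    moreover have "\<forall>\<^sub>F t in at (z x). f (inv_into U z t) * \<phi> (A (inv_into U z t)) $ j
        = \<phi> (scale_section V f A (inv_into U z t)) $ j"
      using eventually_nhds_at[OF eventually_inv_into_chart[OF c(2,3) x x]]
    proof eventually_elim
      case (elim t)
      then have "A (inv_into U z t) \<in> fibre V (inv_into U z t)"
        using meromorphic_is_section[OF A] c(5) by (auto simp: is_section_def)
      then show ?case
        using elim linear_triv_smul(2)[OF lt, of "inv_into U z t"] by (simp add: scale_section_def)
    qed
    ultimately show ?thesis
      by (subst meromorphic_on_cong[OF _ refl, symmetric]) auto
  qed
  then have "(\<lambda>t. \<phi> (scale_section V f A (inv_into U z t)) $ j) meromorphic_on z ` U"
    if "coord_chart X U z" "holo_triv X V U \<phi>"
    for U z j and \<phi> :: "'v \<Rightarrow> complex ^ ('n::{finite, linorder})"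
    by (subst meromorphic_on_meromorphic_at) (use that in blast)
  moreover have "is_section (scale_section V f A)"
    using A by (intro is_section_scale meromorphic_is_section)
  ultimately show ?thesis
    by (simp add: meromorphic_section_def is_section_def)
qed

text \<open>Off its zeros and poles \<open>f\<close> is an admissible scalar factor. The matrix
  \<open>L\<close> depends on \<open>y\<close> but not on the section, so it is shared by
  \<open>f A\<close> and \<open>f B\<close>.\<close>

lemma eventually_wronskian_matrix_scale:
  assumes f: "meromorphic_fun X f" "nonzero_fun X f"
    and U: "coord_chart X U z" "pf_triv X V P U \<phi>" "x \<in> U"
  shows "\<forall>\<^sub>F y in atin T x. y \<in> U \<and>
    (\<exists>L :: complex ^ ('n::{finite, linorder}) ^ ('n::{finite, linorder}). invertible L \<and>
      (\<forall>A. is_section A \<longrightarrow> analytic_in U z \<phi> A y \<longrightarrow> analytic_in U z \<phi> (scale_section V f A) y \<and>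
        wronskian_matrix U z \<phi> (scale_section V f A) (z y) = L ** wronskian_matrix U z \<phi> A (z y)))"
proof -
  note c = coord_chartD[OF U(1)]
  have x: "x \<in> topspace T"
    using c(5) U(3) by blast
  have "(\<lambda>t. f (inv_into U z t)) meromorphic_on {z x}"
    using meromorphic_fun_chart[OF c(1) f(1)] by (rule meromorphic_on_subset) (use U(3) in auto)
  from meromorphic_eventually_analytic[OF this]
    eventually_nhds_at[OF eventually_inv_into_chart[OF c(2,3) U(3,3)]]
  have "\<forall>\<^sub>F s in at (z x). (\<lambda>t. f (inv_into U z t)) analytic_on {z (inv_into U z s)}"
    by eventually_elim simp
  then have "\<forall>\<^sub>F y in atin T x. (\<lambda>t. f (inv_into U z t)) analytic_on {z y}"
    by (simp add: eventually_chart[OF c(2) U(3)])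
  with meromorphic_fun_eventually_nonzero[OF f x] eventually_atin_openin[OF c(3) U(3)]
  show ?thesis
  proof eventually_elim
    case (elim y)
    show ?case
      by (rule wronskian_matrix_scale[OF U(1) pf_trivD(3)[OF U(2)] elim(2,3,1)]) (use elim in blast)
  qed
qed

text \<open>Regularity near a single point suffices, and W(f B) = L W(B) is invertible wherever
  \<open>f\<close> is analytic and nonzero and \<open>B\<close> is regular.\<close>

lemma generic_section_scale:
  assumes B: "generic_section X V P B" and f: "meromorphic_fun X f" "nonzero_fun X f"
  shows "generic_section X V P (scale_section V f B)"
proof -
  obtain x where x: "x \<in> topspace T"
    using riemann_surface unfolding riemann_surface_def by blast
  obtain U z \<phi> where U: "x \<in> U" "coord_chart X U z" "pf_triv X V P U \<phi>"
    using x by (rule pf_chart_exists)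
  show ?thesis
  proof (rule generic_sectionI[OF meromorphic_section_scale[OF _ f(1)] x])
    show "meromorphic_section X V B"
      using B by (simp add: generic_section_def)
    show "\<forall>\<^sub>F y in atin T x. regular_point (scale_section V f B) y"
      using eventually_wronskian_matrix_scale[OF f U(2,3,1)] generic_eventually_regular[OF B x]
    proof eventually_elim
      case (elim y)
      then show ?case
        using regular_pointD[OF generic_is_section[OF B] _ U(2,3)] generic_is_section[OF B] U(2,3)
        unfolding regular_point_def by (metis invertible_mult)
    qed
  qed
qed

lemma wronskian_quotient_scale:
  assumes A: "meromorphic_section X V A" and B: "generic_section X V P B"
    and f: "meromorphic_fun X f" "nonzero_fun X f"
  shows "endo_eq X V (topspace T)
    (wronskian_quotient X V P (scale_section V f A) (scale_section V f B)) (wronskian_quotient X V P A B)"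
    (is "endo_eq X V _ ?Q' ?Q")
proof -
  have Q: "is_wronskian_quotient X V P A B ?Q"
    using A B by (rule is_wronskian_quotient_wronskian_quotient)
  have Q': "is_wronskian_quotient X V P (scale_section V f A) (scale_section V f B) ?Q'"
    using meromorphic_section_scale[OF A f(1)] generic_section_scale[OF B f]
    by (rule is_wronskian_quotient_wronskian_quotient)
  show ?thesis
  proof (rule endo_eqI)
    fix x U z \<phi> assume U: "coord_chart X U z" "pf_triv X V P U \<phi>" "x \<in> U"
    let ?W = "wronskian_matrix U z \<phi>"
    have x: "x \<in> topspace T"
      using coord_chartD(5)[OF U(1)] U(3) by blast
    from eventually_wronskian_matrix_scale[OF f U] eventually_analytic_point[OF A x]
      generic_eventually_regular[OF B x] is_wronskian_quotientD(2)[OF Q U] is_wronskian_quotientD(2)[OF Q' U]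
    show "\<forall>\<^sub>F y in atin T x. \<exists>M. matrix_of_endo V \<phi> y (?Q' y) M \<and> matrix_of_endo V \<phi> y (?Q y) M"
    proof eventually_elim
      case (elim y)
      \<comment> \<open>One \<open>L\<close> is extracted for both sections; it stands to the left
        of both Wronskian matrices and cancels.\<close>
      then obtain L :: "complex ^ ('n::{finite, linorder}) ^ ('n::{finite, linorder})" where
        L: "invertible L" and W: "\<And>A. is_section A \<Longrightarrow> analytic_in U z \<phi> A y \<Longrightarrow>
          ?W (scale_section V f A) (z y) = L ** ?W A (z y)"
        by blast
      have a: "?W (scale_section V f A) (z y) = L ** ?W A (z y)"
        using W meromorphic_is_section[OF A] analytic_pointD[OF meromorphic_is_section[OF A] _ U(1,2)] elim
        by blast
      have b: "?W (scale_section V f B) (z y) = L ** ?W B (z y)" "invertible (?W B (z y))"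
        using W generic_is_section[OF B] regular_pointD[OF generic_is_section[OF B] _ U(1,2)] elim
        by blast+
      have "wronskian_quotient_matrix U z \<phi> (scale_section V f A) (scale_section V f B) (z y)
          = matrix_inv (?W B (z y)) ** (matrix_inv L ** L) ** ?W A (z y)"
        by (simp add: wronskian_quotient_matrix_def a b matrix_inv_mult L matrix_mul_assoc)
      also have "\<dots> = wronskian_quotient_matrix U z \<phi> A B (z y)"
        by (simp add: matrix_inv_left L wronskian_quotient_matrix_def)
      finally show ?case
        using elim by auto
    qed
  qed (use is_wronskian_quotientD(1) Q Q' in blast)+
qed

end

text \<open>Well-definedness comes as agreement of the local quotients on overlaps together with
  existence and almost-everywhere uniqueness of a global meromorphic endomorphism. The scaling part
  also asserts that \<open>f A\<close> is meromorphic and \<open>f B\<close> generic, so that the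
  quotient of the scaled sections is meaningful.\<close>

theorem lemma4p1:
  fixes X :: "'a surface"
    and V :: "('a, 'v, 'n::{finite, linorder}) vbundle"
    and P :: "('a set \<times> ('v \<Rightarrow> complex ^ ('n::{finite, linorder}))) set"
  assumes "riemann_surface X"
    and "holomorphic_vector_bundle X V"
    and "projectively_flat_structure X V P"
  shows
    "(\<forall>A B. meromorphic_section X V A \<longrightarrow> generic_section X V P B \<longrightarrow>
        (\<forall>U z \<phi> U' z' \<phi>'.
           coord_chart X U z \<longrightarrow> pf_triv X V P U \<phi> \<longrightarrow>
           coord_chart X U' z' \<longrightarrow> pf_triv X V P U' \<phi>' \<longrightarrow>
           endo_eq X V (U \<inter> U') (local_wronskian_quotient V U z \<phi> A B)
                                (local_wronskian_quotient V U' z' \<phi>' A B)) \<and>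
        is_wronskian_quotient X V P A B (wronskian_quotient X V P A B) \<and>
        (\<forall>Q. is_wronskian_quotient X V P A B Q \<longrightarrow>
           endo_eq X V (topspace (surf_top X)) Q (wronskian_quotient X V P A B)))
     \<and>
     (\<forall>A B C. generic_section X V P A \<longrightarrow> generic_section X V P B \<longrightarrow> generic_section X V P C \<longrightarrow>
        endo_eq X V (topspace (surf_top X))
          (endo_mult (endo_mult (wronskian_quotient X V P A B) (wronskian_quotient X V P C A))
             (wronskian_quotient X V P B C))
          endo_one)
     \<and>
     (\<forall>A B f. meromorphic_section X V A \<longrightarrow> generic_section X V P B \<longrightarrow>
        meromorphic_fun X f \<longrightarrow> nonzero_fun X f \<longrightarrow>
        meromorphic_section X V (scale_section V f A) \<and>
        generic_section X V P (scale_section V f B) \<and>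
        endo_eq X V (topspace (surf_top X))
          (wronskian_quotient X V P (scale_section V f A) (scale_section V f B))
          (wronskian_quotient X V P A B))"
proof -
  interpret pf_bundle X V P
    using assms by unfold_locales
  show ?thesis
    by (intro conjI allI impI)
      (blast intro: endo_eq_local_wronskian_quotient is_wronskian_quotient_wronskian_quotient
        is_wronskian_quotient_unique wronskian_quotient_cycle meromorphic_section_scale
        generic_section_scale wronskian_quotient_scale)+
qed

end
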